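(* Let $n$ be a sufficiently large positive integer, and let $t$, $\gamma$, $\delta$ and $C$ be as in the context. There exist signs $\varepsilon_k\in\{-1,1\}$ for $k\in C$, defining the cosine polynomial $c(\theta)=\sum_{k\in C}\varepsilon_k\cos(k\theta)$, and a suitable and well-separated collection $\mathcal{I}$ of pairwise disjoint intervals in $\mathbb{R}/2\pi\mathbb{Z}$, such that $|c(\theta)|\ge \delta\sqrt{n}$ for all $\theta\notin\bigcup_{I\in\mathcal{I}}I$, and $|c(\theta)|\le\sqrt{n}$ for all $\theta\in\mathbb{R}/2\pi\mathbb{Z}$.
   Context: Standing setup: $t$ is an odd integer such that $\gamma := (2^{t+11}+2^t-1)/n$ satisfies $2^{-43}<\gamma\le 2^{-40}$; $\delta := 2^{-8}\gamma^{7/2}$; $C := 2C'$ where $C' := \{2^{t+10},\dots,2^{t+10}+2^t-1\}\cup\{2^{t+11},\dots,2^{t+11}+2^t-1\}$ (so $C$ consists of $2^{t+1}$ even integers). A collection $\mathcal{I}$ of pairwise disjoint intervals in $\mathbb{R}/2\pi\mathbb{Z}$ is suitable if (a) the endpoints of each interval in $\mathcal{I}$ lie in $\frac{\pi}{n}\mathbb{Z}$; (b) $\mathcal{I}$ is invariant under the maps $\theta\mapsto\pi+\theta$ and $\theta\mapsto\pi-\theta$; (c) $|\mathcal{I}|=4N$ for some integer $N\le\gamma n$. A suitable collection is well-separated if moreover (d) each $I\in\mathcal{I}$ has length $|I|\le 6\pi/n$; (e) $d(I,J)\ge\pi/n$ for all distinct $I,J\in\mathcal{I}$, where $d(I,J)=\inf\{d(\theta,\theta'):\theta\in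 I,\theta'\in J\}$ and $d(\theta,\theta')$ is the distance mod $2\pi$; (f) $\bigcup_{I\in\mathcal{I}}I$ is disjoint from $(\pi/2)\mathbb{Z}+[-100\pi/n,100\pi/n]$. *)

theory Defs
  imports "HOL-Analysis.Analysis"
begin

text \<open>Points of R/2piZ are represented by real numbers; subsets of R/2piZ by
  2pi-periodic subsets of the reals.\<close>

definition gamma_par :: "nat \<Rightarrow> nat \<Rightarrow> real" where
  "gamma_par n t = (2 ^ (t + 11) + 2 ^ t - 1) / real n"

definition delta_par :: "nat \<Rightarrow> nat \<Rightarrow> real" where
  "delta_par n t = 2 powr (-8) * gamma_par n t powr (7/2)"

definition Cprime :: "nat \<Rightarrow> nat set" where
  "Cprime t = {2 ^ (t + 10) ..< 2 ^ (t + 10) + 2 ^ t} \<union> {2 ^ (t + 11) ..< 2 ^ (t + 11) + 2 ^ t}"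

definition Cset :: "nat \<Rightarrow> nat set" where
  "Cset t = (\<lambda>k. 2 * k) ` Cprime t"

definition cospoly :: "(nat \<Rightarrow> real) \<Rightarrow> nat set \<Rightarrow> real \<Rightarrow> real" where
  "cospoly eps C \<theta> = (\<Sum>k\<in>C. eps k * cos (real k * \<theta>))"

definition arc :: "real \<Rightarrow> real \<Rightarrow> real set" where
  "arc a b = {x. \<exists>k::int. a \<le> x + 2 * pi * of_int k \<and> x + 2 * pi * of_int k \<le> b}"

definition is_arc :: "real set \<Rightarrow> real \<Rightarrow> real \<Rightarrow> bool" where
  "is_arc I a b \<longleftrightarrow> a < b \<and> b - a < 2 * pi \<and> I = arc a b"

definition circ_dist :: "real \<Rightarrow> real \<Rightarrow> real" where
  "circ_dist x y = Inf {\<bar>x - y + 2 * pi * of_int k\<bar> | k::int. True}"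

definition suitable :: "nat \<Rightarrow> real set set \<Rightarrow> bool" where
  "suitable n \<I> \<longleftrightarrow>
     (\<forall>I\<in>\<I>. \<exists>a b. is_arc I a b \<and>
        (\<exists>p::int. a = pi / real n * of_int p) \<and> (\<exists>q::int. b = pi / real n * of_int q))
   \<and> (\<forall>I\<in>\<I>. \<forall>J\<in>\<I>. I \<noteq> J \<longrightarrow> I \<inter> J = {})
   \<and> (\<forall>I\<in>\<I>. (\<lambda>\<theta>. pi + \<theta>) ` I \<in> \<I> \<and> (\<lambda>\<theta>. pi - \<theta>) ` I \<in> \<I>)"

definition suitable_card :: "nat \<Rightarrow> real \<Rightarrow> real set set \<Rightarrow> bool" where
  "suitable_card n \<gamma> \<I> \<longleftrightarrow> finite \<I> \<and> (\<exists>N::nat. card \<I> = 4 * N \<and> real N \<le> \<gamma> * real n)"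

definition well_separated :: "nat \<Rightarrow> real set set \<Rightarrow> bool" where
  "well_separated n \<I> \<longleftrightarrow>
     (\<forall>I\<in>\<I>. \<exists>a b. is_arc I a b \<and> b - a \<le> 6 * pi / real n)
   \<and> (\<forall>I\<in>\<I>. \<forall>J\<in>\<I>. I \<noteq> J \<longrightarrow>
        Inf {circ_dist x y | x y. x \<in> I \<and> y \<in> J} \<ge> pi / real n)
   \<and> (\<forall>\<theta>\<in>\<Union>\<I>. \<forall>m::int. \<bar>\<theta> - pi / 2 * of_int m\<bar> > 100 * pi / real n)"

end

theory Submission
  imports Defs "HOL-Computational_Algebra.Polynomial"
begin

text \<open>Take the signs of the Rudin--Shapiro polynomials \<open>P = P\<^sub>t\<close>, \<open>Q = Q\<^sub>t\<close>, so that with \<open>T = 2\<^sup>t\<close>,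
  \<open>K = 2\<^bsup>t+10\<^esup>\<close> and \<open>w = e\<^bsup>2i\<theta>\<^esup>\<close> we have \<open>c(\<theta>) = Re (w\<^sup>K P(w) + w\<^bsup>2K\<^esup> Q(w))\<close>. Since
  \<open>\<bar>P\<bar>\<^sup>2 + \<bar>Q\<bar>\<^sup>2 = 2T\<close> and \<open>P\<close>, \<open>Q\<close> vary on a scale \<open>2\<^sup>10\<close> times longer than \<open>w\<^sup>K\<close>, the function \<open>c\<close> behaves
  locally like a sum of two waves with frequency ratio \<open>1 : 2\<close>, and the derivatives of orders \<open>0\<close> to \<open>3\<close>
  cannot all be small at one point. If seven consecutive cells \<open>[i \<pi>/n, (i+1) \<pi>/n]\<close> each contained a point with
  \<open>\<bar>c\<bar> < \<delta> sqrt n\<close>, divided differences over four of them would make all four derivatives small.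
  Hence the maximal runs of cells containing such a point have at most six cells, and they are the
  intervals sought. At multiples of \<open>\<pi>/2\<close> we have \<open>c = sqrt (2T)\<close> because \<open>t\<close> is odd, which keeps the
  runs away from these points. On each run \<open>c\<^sup>2 - \<delta>\<^sup>2 n\<close>, a polynomial of degree \<open>2 \<gamma> n\<close> in \<open>cos (2\<theta>)\<close>,
  changes sign twice, so a quadrant contains at most \<open>\<gamma> n\<close> runs.\<close>

section \<open>Exponential sums and Rudin--Shapiro polynomials\<close>

text \<open>The \<open>j\<close>-th derivative of the exponential sum with coefficients \<open>a\<close> and frequencies
  \<open>l, l + m, \<dots>, l + m (N - 1)\<close>.\<close>

definition wave :: "real \<Rightarrow> real \<Rightarrow> nat \<Rightarrow> (nat \<Rightarrow> real) \<Rightarrow> nat \<Rightarrow> real \<Rightarrow> complex" where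
  "wave l m j a N u =
     (\<Sum>k<N. of_real (a k) * (\<i> * of_real (l + m * real k)) ^ j * cis ((l + m * real k) * u))"

text \<open>The factor \<open>cis (l * u)\<close> splits off and the binomial theorem expands the
  \<open>j\<close>-th power of \<open>l + m * k\<close>, so every wave reduces to waves with offset
  0 and step 1 at the point \<open>m * u\<close>.\<close>

lemma wave_expand:
  "wave l m j a N u = cis (l * u) *
     (\<Sum>i\<le>j. of_nat (j choose i) * (\<i> * of_real l) ^ (j - i) * of_real m ^ i * wave 0 1 i a N (m * u))"
proof -
  have summand: "of_real (a k) * (\<i> * of_real (l + m * real k)) ^ j * cis ((l + m * real k) * u) =
      (\<Sum>i\<le>j. cis (l * u) * (of_nat (j choose i) * (\<i> * of_real l) ^ (j - i) * of_real m ^ i *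
        (of_real (a k) * (\<i> * of_real (0 + 1 * real k)) ^ i * cis ((0 + 1 * real k) * (m * u)))))" for k
  proof -
    have "(\<i> * of_real (l + m * real k)) ^ j = (of_real m * (\<i> * of_real (real k)) + \<i> * of_real l) ^ j"
      by (simp add: algebra_simps)
    also have "\<dots> = (\<Sum>i\<le>j. of_nat (j choose i) * (of_real m * (\<i> * of_real (real k))) ^ i * (\<i> * of_real l) ^ (j - i))"
      by (rule binomial_ring)
    finally have 1: "(\<i> * of_real (l + m * real k)) ^ j = \<dots>" .
    have 2: "cis ((l + m * real k) * u) = cis (l * u) * cis (real k * (m * u))"
      by (simp add: cis_mult algebra_simps)
    show ?thesis
      unfolding 1 2 by (simp add: sum_distrib_left sum_distrib_right power_mult_distrib mult_ac)
  qed
  show ?thesis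
    unfolding wave_def summand by (subst sum.swap) (simp add: sum_distrib_left)
qed

lemma wave_has_derivative:
  "(wave l m j a N has_vector_derivative wave l m (Suc j) a N u) (at u)"
proof -
  have "((\<lambda>x. cis (c * x)) has_vector_derivative (\<i> * of_real c) * cis (c * u)) (at u)" for c :: real
  proof -
    have "((\<lambda>z. exp (\<i> * of_real c * z)) has_field_derivative \<i> * of_real c * exp (\<i> * of_real c * of_real u))
        (at (of_real u))"
      by (auto intro!: derivative_eq_intros)
    from has_vector_derivative_real_field[OF this] show ?thesis
      by (simp add: cis_conv_exp mult.assoc)
  qed
  then have "((\<lambda>x. of_real (a k) * (\<i> * of_real (l + m * real k)) ^ j * cis ((l + m * real k) * x))
     has_vector_derivative of_real (a k) * (\<i> * of_real (l + m * real k)) ^ j *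
       ((\<i> * of_real (l + m * real k)) * cis ((l + m * real k) * u))) (at u)" for k
    by (intro has_vector_derivative_mult_right)
  then have "((\<lambda>x. wave l m j a N x) has_vector_derivative
      (\<Sum>k<N. of_real (a k) * (\<i> * of_real (l + m * real k)) ^ j *
       ((\<i> * of_real (l + m * real k)) * cis ((l + m * real k) * u)))) (at u)"
    unfolding wave_def by (intro has_vector_derivative_sum)
  then show ?thesis
    unfolding wave_def by (simp add: mult_ac)
qed

text \<open>Rudin--Shapiro signs: \<open>rs t 1\<close> and \<open>rs t (-1)\<close> are the coefficients of \<open>P\<^sub>t\<close> and \<open>Q\<^sub>t\<close>,
  where \<open>P\<^sub>0 = Q\<^sub>0 = 1\<close> and \<open>P\<^sub>t\<^sub>+\<^sub>1, Q\<^sub>t\<^sub>+\<^sub>1 = P\<^sub>t \<plusminus> z\<^bsup>2^t\<^esup> Q\<^sub>t\<close>.\<close>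

primrec rs :: "nat \<Rightarrow> real \<Rightarrow> nat \<Rightarrow> real" where
  "rs 0 s k = 1"
| "rs (Suc t) s k = (if k < 2 ^ t then rs t 1 k else s * rs t (-1) (k - 2 ^ t))"

lemma rs_sign: "s \<in> {1, -1} \<Longrightarrow> rs t s k \<in> {1, -1}"
proof (induction t arbitrary: s k)
  case (Suc t)
  show ?case
    using Suc.IH[of 1 k] Suc.IH[of "-1" "k - 2 ^ t"] Suc.prems by auto
qed simp

abbreviation rsw :: "nat \<Rightarrow> real \<Rightarrow> nat \<Rightarrow> real \<Rightarrow> complex" where
  "rsw t s j \<equiv> wave 0 1 j (rs t s) (2 ^ t)"

lemma sum_lessThan_add:
  "(\<Sum>k<m + n. f k) = (\<Sum>k<m. f k) + (\<Sum>k<n. f (m + k))" for f :: "nat \<Rightarrow> 'a::comm_monoid_add"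
  by (induction n) (simp_all add: add.assoc)

text \<open>The sum splits at \<open>k = 2 ^ t\<close>. The second half stays a wave with offset
  \<open>2 ^ t\<close>, from which \<open>wave_expand\<close> later extracts the factor z^(2^t)
  together with its derivatives.\<close>

lemma rsw_Suc:
  "rsw (Suc t) s j x = rsw t 1 j x + of_real s * wave (2 ^ t) 1 j (rs t (-1)) (2 ^ t) x"
proof -
  let ?g = "\<lambda>k. of_real (rs (Suc t) s k) * (\<i> * of_real (0 + 1 * real k)) ^ j * cis ((0 + 1 * real k) * x)"
  have "sum ?g {..<2 ^ Suc t} = sum ?g {..<2 ^ t + 2 ^ t}"
    by (simp add: mult_2)
  also have "\<dots> = sum ?g {..<2 ^ t} + (\<Sum>k<2 ^ t. ?g (2 ^ t + k))"
    by (rule sum_lessThan_add)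
  finally show ?thesis
    unfolding wave_def by (simp add: sum_distrib_left mult_ac)
qed

text \<open>The parallelogram law, phrased with the product norm so that a Rudin--Shapiro step acts
  on the pair as one vector.\<close>

lemma norm_pair_add_diff: "norm (x + y, x - y) = sqrt 2 * norm (x, y)" for x y :: complex
proof -
  have "(norm (x + y))\<^sup>2 + (norm (x - y))\<^sup>2 = 2 * ((norm x)\<^sup>2 + (norm y)\<^sup>2)"
    unfolding cmod_power2 by (simp add: power2_eq_square algebra_simps)
  then show ?thesis
    by (simp only: norm_Pair real_sqrt_mult)
qed

text \<open>Each step multiplies the second component by a number of modulus 1 and then takes sum
  and difference, which scales the norm of the pair by \<open>sqrt 2\<close>.\<close>

lemma norm_rsw_0: "norm (rsw t 1 0 x, rsw t (-1) 0 x) = sqrt (2 * 2 ^ t)"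
proof (induction t)
  case 0
  then show ?case by (simp add: wave_def norm_Pair)
next
  case (Suc t)
  let ?B = "wave (2 ^ t) 1 0 (rs t (-1)) (2 ^ t) x"
  have B: "?B = cis (2 ^ t * x) * rsw t (-1) 0 x"
    by (subst wave_expand) simp
  have "norm (rsw (Suc t) 1 0 x, rsw (Suc t) (-1) 0 x) = sqrt 2 * norm (rsw t 1 0 x, ?B)"
    by (simp only: rsw_Suc norm_pair_add_diff[symmetric]) simp
  also have "norm (rsw t 1 0 x, ?B) = norm (rsw t 1 0 x, rsw t (-1) 0 x)"
    by (simp add: B norm_Pair norm_mult)
  finally show ?case using Suc by (simp add: real_sqrt_mult)
qed

text \<open>Bernstein's inequality for the pair follows by induction on \<open>t\<close>: the parallelogram law gives
  the factor \<open>sqrt 2\<close>, and the binomial coefficients from differentiating \<open>z\<^bsup>2^t\<^esup> Q\<^sub>t\<close> add up to \<open>2\<^sup>j\<close>.\<close>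

lemma norm_rsw_le: "norm (rsw t 1 j x, rsw t (-1) j x) \<le> (2 ^ t) ^ j * sqrt (2 * 2 ^ t)"
proof (induction t arbitrary: j)
  case 0
  then show ?case
    by (cases "j = 0") (auto simp: wave_def norm_Pair zero_power)
next
  case (Suc t)
  let ?M = "sqrt (2 * 2 ^ t)" and ?T = "2 ^ t :: real"
  let ?B = "wave (2 ^ t) 1 j (rs t (-1)) (2 ^ t) x"
  let ?b = "\<lambda>i. of_nat (j choose i) * (\<i> * of_real ?T) ^ (j - i) * rsw t (-1) i x"
  have B: "?B = cis (2 ^ t * x) * (\<Sum>i\<le>j. ?b i)"
    by (subst wave_expand) simp
  have nb: "norm (?b i) \<le> real (j choose i) * (?T ^ j * ?M)" if "i \<le> j" for i
  proof -
    have "norm (rsw t (-1) i x) \<le> norm (rsw t 1 i x, rsw t (-1) i x)"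
      by (rule norm_snd_le)
    also note Suc
    finally have "?T ^ (j - i) * norm (rsw t (-1) i x) \<le> ?T ^ (j - i) * (?T ^ i * ?M)"
      by (intro mult_left_mono) auto
    also have "\<dots> = ?T ^ j * ?M"
      using that by (simp flip: power_add mult.assoc)
    finally show ?thesis
      by (simp add: norm_mult norm_power mult_left_mono mult.assoc)
  qed
  have "norm (rsw (Suc t) 1 j x, rsw (Suc t) (-1) j x) = sqrt 2 * norm (rsw t 1 j x, ?B)"
    by (simp only: rsw_Suc norm_pair_add_diff[symmetric]) simp
  also have "norm (rsw t 1 j x, ?B) = norm (rsw t 1 j x, \<Sum>i\<le>j. ?b i)"
    by (simp add: B norm_Pair norm_mult)
  \<comment> \<open>The term \<open>i = j\<close> has coefficient 1 and joins the first component in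
    the pair bounded by the induction hypothesis; only the terms \<open>i < j\<close> are estimated
    one by one.\<close>
  also have "(rsw t 1 j x, \<Sum>i\<le>j. ?b i) = (rsw t 1 j x, rsw t (-1) j x) + (0, \<Sum>i<j. ?b i)"
    by (simp add: lessThan_Suc_atMost[symmetric])
  finally have "norm (rsw (Suc t) 1 j x, rsw (Suc t) (-1) j x) =
      sqrt 2 * norm ((rsw t 1 j x, rsw t (-1) j x) + (0, \<Sum>i<j. ?b i))" .
  moreover have "norm ((rsw t 1 j x, rsw t (-1) j x) + (0, \<Sum>i<j. ?b i)) \<le> 2 ^ j * (?T ^ j * ?M)"
  proof -
    have "norm (\<Sum>i<j. ?b i) \<le> (\<Sum>i<j. real (j choose i) * (?T ^ j * ?M))"
      by (rule sum_norm_le) (use nb in auto)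
    then have "norm ((rsw t 1 j x, rsw t (-1) j x) + (0, \<Sum>i<j. ?b i)) \<le>
        ?T ^ j * ?M + (\<Sum>i<j. real (j choose i) * (?T ^ j * ?M))"
      by (intro order_trans[OF norm_triangle_ineq] add_mono) (simp_all only: Suc norm_Pair1)
    also have "\<dots> = (\<Sum>i\<le>j. real (j choose i)) * (?T ^ j * ?M)"
      by (simp add: lessThan_Suc_atMost[symmetric] sum_distrib_right distrib_right del: of_nat_sum)
    also have "\<dots> = 2 ^ j * (?T ^ j * ?M)"
      using choose_row_sum[of j] by (metis of_nat_numeral of_nat_power of_nat_sum)
    finally show ?thesis .
  qed
  ultimately have "norm (rsw (Suc t) 1 j x, rsw (Suc t) (-1) j x) \<le> sqrt 2 * (2 ^ j * (?T ^ j * ?M))"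
    by (simp only: mult_left_mono real_sqrt_ge_zero zero_le_numeral)
  also have "\<dots> = (2 ^ Suc t) ^ j * sqrt (2 * 2 ^ Suc t)"
    by (simp add: real_sqrt_mult power_mult_distrib)
  finally show ?case .
qed

lemma norm_rsw: "s \<in> {1, -1} \<Longrightarrow> norm (rsw t s j x) \<le> (2 ^ t) ^ j * sqrt (2 * 2 ^ t)"
  using norm_rsw_le[where t = t and j = j and x = x] norm_fst_le[of "rsw t 1 j x" "rsw t (-1) j x"]
    norm_snd_le[of "rsw t (-1) j x" "rsw t 1 j x"] by auto

text \<open>At z = 1 or z = -1 the factor z^(2^t) is 1 once t >= 1, so two steps of the recursion
  turn P + Q into 2 (P + Q). Oddness of \<open>t\<close> lets the induction start at 1, where P + Q
  = 2.\<close>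

lemma rsw_pi:
  assumes "odd t"
  shows "rsw t 1 0 (real_of_int m * pi) + rsw t (-1) 0 (real_of_int m * pi) = of_real (sqrt (2 * 2 ^ t))"
proof -
  let ?x = "real_of_int m * pi"
  have step: "rsw (Suc t) s 0 ?x = rsw t 1 0 ?x + of_real s * cis (2 ^ t * ?x) * rsw t (-1) 0 ?x" for t s
    unfolding rsw_Suc by (subst wave_expand) simp
  have one: "cis (2 ^ Suc t * ?x) = 1" for t
  proof -
    have "2 ^ Suc t * ?x = 2 * pi * real_of_int (2 ^ t * m)" by simp
    then show ?thesis by (metis cis_multiple_2pi Ints_of_int)
  qed
  have "rsw (2 * i + 1) 1 0 ?x + rsw (2 * i + 1) (-1) 0 ?x = of_real (sqrt (2 * 2 ^ (2 * i + 1)))" for i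
  proof (induction i)
    case 0
    have "2 * 0 + 1 = Suc 0" by simp
    then show ?case by (simp only: step) (simp add: wave_def)
  next
    case (Suc i)
    have eq: "2 * Suc i + 1 = Suc (Suc (2 * i + 1))" by simp
    have "rsw (2 * Suc i + 1) 1 0 ?x + rsw (2 * Suc i + 1) (-1) 0 ?x =
      2 * (rsw (2 * i + 1) 1 0 ?x + cis (2 ^ (2 * i + 1) * ?x) * rsw (2 * i + 1) (-1) 0 ?x)"
      unfolding eq by (simp only: step) (simp add: algebra_simps)
    also have "cis (2 ^ (2 * i + 1) * ?x) = 1"
      using one[of "2 * i"] by simp
    also have "2 * (rsw (2 * i + 1) 1 0 ?x + 1 * rsw (2 * i + 1) (-1) 0 ?x) =
        of_real (2 * sqrt (2 * 2 ^ (2 * i + 1)))"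
      by (simp only: Suc mult_1_left) simp
    also have "2 * sqrt (2 * 2 ^ (2 * i + 1)) = sqrt (2 * 2 ^ (2 * Suc i + 1))"
      by (simp add: real_sqrt_mult)
    finally show ?case .
  qed
  then show ?thesis using assms by (auto elim!: oddE)
qed

text \<open>In \<open>wave_expand\<close> the term \<open>i = 0\<close> is the oscillation of
  frequency \<open>l\<close> modulated by the basic wave, and each term is at most \<open>M\<close>
  times its share of the binomial expansion of \<open>(l + m * T) ^ j\<close>. Removing the term
  \<open>i = 0\<close> from this sum leaves the error.\<close>

lemma
  assumes bound: "\<And>i x. norm (wave 0 1 i a N x) \<le> T ^ i * M"
    and nonneg: "0 \<le> l" "0 \<le> m" "0 \<le> T"
  shows norm_wave_diff: "norm (wave l m j a N u - (\<i> * of_real l) ^ j * (cis (l * u) * wave 0 1 0 a N (m * u)))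
      \<le> ((l + m * T) ^ j - l ^ j) * M"
    and norm_wave: "norm (wave l m j a N u) \<le> (l + m * T) ^ j * M"
proof -
  let ?s = "\<lambda>i. of_nat (j choose i) * (\<i> * of_real l) ^ (j - i) * of_real m ^ i * wave 0 1 i a N (m * u)"
  let ?b = "\<lambda>i. real (j choose i) * (m * T) ^ i * l ^ (j - i)"
  have s: "norm (?s i) \<le> ?b i * M" for i
  proof -
    have "real (j choose i) * l ^ (j - i) * m ^ i * norm (wave 0 1 i a N (m * u)) \<le>
        real (j choose i) * l ^ (j - i) * m ^ i * (T ^ i * M)"
      using nonneg by (intro mult_left_mono bound) auto
    then show ?thesis
      using nonneg by (simp add: norm_mult norm_power power_mult_distrib mult_ac)
  qed
  have sum_b: "(\<Sum>i\<le>j. ?b i) = (l + m * T) ^ j"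
    by (subst add.commute) (simp add: binomial_ring)
  have w: "wave l m j a N u = cis (l * u) * (\<Sum>i\<le>j. ?s i)"
    by (rule wave_expand)
  show "norm (wave l m j a N u) \<le> (l + m * T) ^ j * M"
    unfolding w norm_mult sum_b[symmetric] sum_distrib_right using s by (simp add: sum_norm_le)
  have "wave l m j a N u - (\<i> * of_real l) ^ j * (cis (l * u) * wave 0 1 0 a N (m * u)) =
      cis (l * u) * (\<Sum>i<j. ?s (Suc i))"
    unfolding w by (simp add: sum.atMost_shift algebra_simps)
  also have "norm \<dots> \<le> (\<Sum>i<j. ?b (Suc i) * M)"
    unfolding norm_mult using s by (simp add: sum_norm_le del: binomial_Suc_Suc power_Suc)
  also have "\<dots> = ((l + m * T) ^ j - l ^ j) * M"
    unfolding sum_b[symmetric] sum.atMost_shift[of ?b] by (simp add: sum_distrib_right)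
  finally show "norm (wave l m j a N u - (\<i> * of_real l) ^ j * (cis (l * u) * wave 0 1 0 a N (m * u)))
      \<le> ((l + m * T) ^ j - l ^ j) * M" .
qed

text \<open>\<open>rsF t 0\<close> is the cosine polynomial in the variable \<open>u = 2 K \<theta>\<close> with \<open>K = 2\<^bsup>t+10\<^esup>\<close>, in which its
  two blocks have frequencies close to \<open>1\<close> and \<open>2\<close>; \<open>rsF t j\<close> is its \<open>j\<close>-th derivative.\<close>

definition rsF :: "nat \<Rightarrow> nat \<Rightarrow> real \<Rightarrow> real" where
  "rsF t j u = Re (wave 1 (1 / (1024 * 2 ^ t)) j (rs t 1) (2 ^ t) u
                 + wave 2 (1 / (1024 * 2 ^ t)) j (rs t (-1)) (2 ^ t) u)"

abbreviation rsM :: "nat \<Rightarrow> real" where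
  "rsM t \<equiv> sqrt (2 * 2 ^ t)"

lemma rsF_deriv: "(rsF t j has_real_derivative rsF t (Suc j) u) (at u)"
  unfolding rsF_def has_real_derivative_iff_has_vector_derivative
  by (intro bounded_linear.has_vector_derivative[OF bounded_linear_Re]
      has_vector_derivative_add wave_has_derivative)

text \<open>Each block has width 1/1024 in frequency, so all frequencies are below 3.\<close>

lemma abs_rsF_le: "\<bar>rsF t j u\<bar> \<le> 2 * 3 ^ j * rsM t"
proof -
  let ?m = "1 / (1024 * 2 ^ t) :: real"
  have "norm (wave l ?m j (rs t s) (2 ^ t) u) \<le> 3 ^ j * rsM t" if "l \<in> {1, 2}" "s \<in> {1, -1}" for l s
  proof -
    have "norm (wave l ?m j (rs t s) (2 ^ t) u) \<le> (l + ?m * 2 ^ t) ^ j * rsM t"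
      by (rule norm_wave) (use that norm_rsw in auto)
    also have "\<dots> \<le> 3 ^ j * rsM t"
      using that by (intro mult_right_mono power_mono) auto
    finally show ?thesis .
  qed
  from this[of 1 1] this[of 2 "-1"]
  have "norm (wave 1 ?m j (rs t 1) (2 ^ t) u + wave 2 ?m j (rs t (-1)) (2 ^ t) u) \<le> 2 * 3 ^ j * rsM t"
    by (intro norm_triangle_le) simp
  then show ?thesis
    unfolding rsF_def by (rule order_trans[OF abs_Re_le_cmod])
qed

text \<open>With \<open>x = e\<^sup>i\<^sup>u P\<close> and \<open>y = e\<^sup>2\<^sup>i\<^sup>u Q\<close>, the derivatives of orders \<open>0, 1, 2, 3\<close> are close to
  \<open>Re x + Re y\<close>, \<open>-(Im x + 2 Im y)\<close>, \<open>-(Re x + 4 Re y)\<close>, \<open>Im x + 8 Im y\<close>. These determine \<open>x\<close>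
  and \<open>y\<close>, which are not both small.\<close>

lemma rsF_nondegenerate:
  assumes "\<bar>rsF t 0 u\<bar> \<le> rsM t / 64" "\<bar>rsF t 1 u\<bar> \<le> rsM t / 64"
    "\<bar>rsF t 2 u\<bar> \<le> rsM t / 64" "\<bar>rsF t 3 u\<bar> \<le> rsM t / 4"
  shows False
proof -
  let ?m = "1 / (1024 * 2 ^ t) :: real" and ?M = "rsM t"
  define x where "x = cis u * rsw t 1 0 (?m * u)"
  define y where "y = cis (2 * u) * rsw t (-1) 0 (?m * u)"
  have M: "?M > 0" by simp
  have w1: "norm (wave 1 ?m j (rs t 1) (2 ^ t) u - \<i> ^ j * x) \<le> ((1 + 1/1024) ^ j - 1) * ?M" for j
    using norm_wave_diff[of "rs t 1" "2 ^ t" "2 ^ t" ?M 1 ?m j u, OF norm_rsw] by (simp add: x_def)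
  have w2: "norm (wave 2 ?m j (rs t (-1)) (2 ^ t) u - (2 * \<i>) ^ j * y) \<le> ((2 + 1/1024) ^ j - 2 ^ j) * ?M" for j
    using norm_wave_diff[of "rs t (-1)" "2 ^ t" "2 ^ t" ?M 2 ?m j u, OF norm_rsw] by (simp add: y_def mult.commute)
  have err: "\<bar>rsF t j u - Re (\<i> ^ j * x + (2 * \<i>) ^ j * y)\<bar>
      \<le> (((1 + 1/1024) ^ j - 1) + ((2 + 1/1024) ^ j - 2 ^ j)) * ?M" for j
  proof -
    have "rsF t j u - Re (\<i> ^ j * x + (2 * \<i>) ^ j * y) =
       Re ((wave 1 ?m j (rs t 1) (2 ^ t) u - \<i> ^ j * x) + (wave 2 ?m j (rs t (-1)) (2 ^ t) u - (2 * \<i>) ^ j * y))"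
      unfolding rsF_def by (simp only: minus_complex.sel plus_complex.sel algebra_simps)
    then show ?thesis
      unfolding distrib_right
      using order_trans[OF abs_Re_le_cmod norm_triangle_mono[OF w1 w2]] by metis
  qed
  have i3: "\<i> ^ 3 = - \<i>" by (simp add: power3_eq_cube)
  have e: "Re (\<i> ^ 0 * x + (2 * \<i>) ^ 0 * y) = Re x + Re y"
      "Re (\<i> ^ 1 * x + (2 * \<i>) ^ 1 * y) = - Im x - 2 * Im y"
      "Re (\<i> ^ 2 * x + (2 * \<i>) ^ 2 * y) = - Re x - 4 * Re y"
      "Re (\<i> ^ 3 * x + (2 * \<i>) ^ 3 * y) = Im x + 8 * Im y"
    by (simp_all add: power_mult_distrib i3)
  \<comment> \<open>The worst case \<open>j = 3\<close> is 15/1024 plus terms of order 2^(-20), just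
    below 16/1024.\<close>
  have "((1 + 1/1024) ^ j - 1) + ((2 + 1/1024) ^ j - 2 ^ j) \<le> (1/64 :: real)" if "j \<in> {0, 1, 2, 3}" for j :: nat
    using that by (auto simp: power2_eq_square power3_eq_cube)
  then have err': "\<bar>rsF t j u - Re (\<i> ^ j * x + (2 * \<i>) ^ j * y)\<bar> \<le> ?M / 64" if "j \<in> {0, 1, 2, 3}" for j
    using order_trans[OF err mult_right_mono, of j "1/64"] that by simp
  have d: "\<bar>rsF t 0 u - (Re x + Re y)\<bar> \<le> ?M / 64"
      "\<bar>rsF t 1 u - (- Im x - 2 * Im y)\<bar> \<le> ?M / 64"
      "\<bar>rsF t 2 u - (- Re x - 4 * Re y)\<bar> \<le> ?M / 64"
      "\<bar>rsF t 3 u - (Im x + 8 * Im y)\<bar> \<le> ?M / 64"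
    using err'[of 0, unfolded e] err'[of 1, unfolded e] err'[of 2, unfolded e] err'[of 3, unfolded e] by blast+
  \<comment> \<open>Even orders involve only real parts and odd orders only imaginary parts, which
    leaves two separate 2 by 2 linear systems.\<close>
  have "\<bar>Re x + Re y\<bar> \<le> ?M / 32"
    using d(1) assms(1) by linarith
  moreover have "\<bar>Re x + 4 * Re y\<bar> \<le> ?M / 32"
    using d(3) assms(3) by linarith
  ultimately have re: "\<bar>Re x\<bar> \<le> ?M / 4" "\<bar>Re y\<bar> \<le> ?M / 4"
    by linarith+
  have "\<bar>Im x + 2 * Im y\<bar> \<le> ?M / 32"
    using d(2) assms(2) by linarith
  moreover have "\<bar>Im x + 8 * Im y\<bar> \<le> 17 * ?M / 64"
    using d(4) assms(4) by linarith
  ultimately have im: "\<bar>Im x\<bar> \<le> ?M / 4" "\<bar>Im y\<bar> \<le> ?M / 4"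
    by linarith+
  have sq: "z\<^sup>2 \<le> ?M\<^sup>2 / 16" if "\<bar>z\<bar> \<le> ?M / 4" for z :: real
    using power_mono[OF that, of 2] by (simp add: power_divide)
  \<comment> \<open>The sum of the squared moduli is exactly \<open>?M\<close> squared, while four
    coordinates of size at most \<open>?M / 4\<close> account for only a quarter of it.\<close>
  have "(norm x)\<^sup>2 + (norm y)\<^sup>2 = (norm (x, y))\<^sup>2"
    by (simp add: norm_Pair)
  also have "norm (x, y) = norm (rsw t 1 0 (?m * u), rsw t (-1) 0 (?m * u))"
    by (simp add: x_def y_def norm_Pair norm_mult)
  also have "\<dots> = ?M" by (rule norm_rsw_0)
  finally have "(Re x)\<^sup>2 + (Im x)\<^sup>2 + ((Re y)\<^sup>2 + (Im y)\<^sup>2) = ?M\<^sup>2"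
    by (simp only: cmod_power2)
  moreover have "?M\<^sup>2 > 0" using M by simp
  moreover have "(Re x)\<^sup>2 \<le> ?M\<^sup>2 / 16" "(Im x)\<^sup>2 \<le> ?M\<^sup>2 / 16" "(Re y)\<^sup>2 \<le> ?M\<^sup>2 / 16" "(Im y)\<^sup>2 \<le> ?M\<^sup>2 / 16"
    using re im sq by blast+
  ultimately show False by linarith
qed

text \<open>\<open>2 ^ (t + 12)\<close> is the least element of the doubled second block. Halving
  and subtracting the start of the block recovers the index of the coefficient.\<close>

definition rs_eps :: "nat \<Rightarrow> nat \<Rightarrow> real" where
  "rs_eps t k = (if k < 2 ^ (t + 12) then rs t 1 (k div 2 - 2 ^ (t + 10))
                 else rs t (-1) (k div 2 - 2 ^ (t + 11)))"

lemma rs_eps_sign: "rs_eps t k = 1 \<or> rs_eps t k = -1"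
  using rs_sign[of 1] rs_sign[of "-1"] by (auto simp: rs_eps_def)

lemma cospoly_double:
  "cospoly e (Cset t) \<theta> = (\<Sum>k\<in>Cprime t. e (2 * k) * cos (real k * (2 * \<theta>)))"
  unfolding cospoly_def Cset_def
  by (subst sum.reindex) (auto simp: inj_on_def mult_ac)

text \<open>With K = 1024 * 2^t and u = 2 K \<theta>, the phases 2 (K + k) \<theta> and 2 (2 K + k)
  \<theta> are (1 + k/K) u and (2 + k/K) u.\<close>

lemma cospoly_rs_eps: "cospoly (rs_eps t) (Cset t) \<theta> = rsF t 0 (2048 * 2 ^ t * \<theta>)"
proof -
  let ?g = "\<lambda>k. rs_eps t (2 * k) * cos (real k * (2 * \<theta>))"
  have shift: "sum ?g {a..<a + 2 ^ t} = (\<Sum>k<2 ^ t. ?g (a + k))" for a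
    using sum.shift_bounds_nat_ivl[of ?g 0 a "2 ^ t"] by (simp add: add.commute lessThan_atLeast0)
  have "2 ^ (t + 10) + (2::nat) ^ t \<le> 2 ^ (t + 11)"
    by (simp add: power_add)
  then have "cospoly (rs_eps t) (Cset t) \<theta> =
      (\<Sum>k<2 ^ t. ?g (2 ^ (t + 10) + k)) + (\<Sum>k<2 ^ t. ?g (2 ^ (t + 11) + k))"
    unfolding cospoly_double Cprime_def shift[symmetric] by (subst sum.union_disjoint) auto
  also have "(\<Sum>k<2 ^ t. ?g (2 ^ (t + 10) + k)) =
      Re (wave 1 (1 / (1024 * 2 ^ t)) 0 (rs t 1) (2 ^ t) (2048 * 2 ^ t * \<theta>))"
  proof -
    have "rs_eps t (2 * (2 ^ (t + 10) + k)) = rs t 1 k" if "k < 2 ^ t" for k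
      using that by (simp add: rs_eps_def power_add)
    then show ?thesis
      unfolding wave_def by (auto intro!: sum.cong arg_cong[where f = cos] simp: field_simps power_add)
  qed
  also have "(\<Sum>k<2 ^ t. ?g (2 ^ (t + 11) + k)) =
      Re (wave 2 (1 / (1024 * 2 ^ t)) 0 (rs t (-1)) (2 ^ t) (2048 * 2 ^ t * \<theta>))"
  proof -
    have "rs_eps t (2 * (2 ^ (t + 11) + k)) = rs t (-1) k" if "k < 2 ^ t" for k
      using that by (simp add: rs_eps_def power_add)
    then show ?thesis
      unfolding wave_def by (auto intro!: sum.cong arg_cong[where f = cos] simp: field_simps power_add)
  qed
  finally show ?thesis
    by (simp add: rsF_def)
qed

text \<open>Here u is an even multiple of pi, so both carrier waves equal 1, and the rescaled
  argument u/K is \<open>m * pi\<close>, where \<open>rsw_pi\<close> gives P + Q.\<close>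

lemma rsF_half_pi:
  assumes "odd t"
  shows "rsF t 0 (2048 * 2 ^ t * (pi / 2 * real_of_int m)) = rsM t"
proof -
  have one: "cis (l * (2048 * 2 ^ t * (pi / 2 * real_of_int m))) = 1" if "l \<in> {1, 2}" for l
  proof -
    have "l * (2048 * 2 ^ t * (pi / 2 * real_of_int m)) = 2 * pi * real_of_int (\<lfloor>l\<rfloor> * 512 * 2 ^ t * m)"
      using that by auto
    then show ?thesis by (metis cis_multiple_2pi Ints_of_int)
  qed
  have arg: "1 / (1024 * 2 ^ t) * (2048 * 2 ^ t * (pi / 2 * real_of_int m)) = real_of_int m * pi"
    by simp
  have "wave l (1 / (1024 * 2 ^ t)) 0 (rs t s) (2 ^ t) (2048 * 2 ^ t * (pi / 2 * real_of_int m)) =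
      rsw t s 0 (real_of_int m * pi)" if "l \<in> {1, 2}" for l s
    by (subst wave_expand, subst arg) (simp only: one[OF that], simp)
  then have "rsF t 0 (2048 * 2 ^ t * (pi / 2 * real_of_int m)) =
     Re (rsw t 1 0 (real_of_int m * pi) + rsw t (-1) 0 (real_of_int m * pi))"
    unfolding rsF_def by simp
  also have "\<dots> = rsM t" unfolding rsw_pi[OF assms] by simp
  finally show ?thesis .
qed

section \<open>Divided differences\<close>

lemma divided_difference1:
  fixes f0 f1 :: "real \<Rightarrow> real"
  assumes f1: "\<And>x. (f0 has_real_derivative f1 x) (at x)"
    and h: "0 < h" "x1 + h \<le> x2"
    and small: "\<And>x. x \<in> {x1, x2} \<Longrightarrow> \<bar>f0 x\<bar> \<le> e"
  shows "\<exists>z. x1 < z \<and> z < x2 \<and> \<bar>f1 z\<bar> \<le> 2 * e / h"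
proof -
  have "x1 < x2" using h by linarith
  then obtain z where z: "x1 < z" "z < x2" "f0 x2 - f0 x1 = (x2 - x1) * f1 z"
    using MVT2[of x1 x2 f0 f1] f1 by blast
  have "h * \<bar>f1 z\<bar> \<le> (x2 - x1) * \<bar>f1 z\<bar>"
    using h by (intro mult_right_mono) auto
  also have "\<dots> = \<bar>f0 x2 - f0 x1\<bar>"
    using z h by (simp add: abs_mult)
  also have "\<dots> \<le> 2 * e"
    using small[of x1] small[of x2] by auto
  finally show ?thesis
    using z h by (auto simp: field_simps)
qed

text \<open>One step of the recursion for divided differences at points at least \<open>h\<close>
  apart. After k steps the bound is e (2/h)^k; the factor k! between divided difference and
  derivative then gives the constants 2, 8 and 48.\<close>

lemma abs_quotient_le:
  fixes a b :: real
  assumes "\<bar>a\<bar> \<le> e" "\<bar>b\<bar> \<le> e" "0 < h" "h \<le> d"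
  shows "\<bar>(b - a) / d\<bar> \<le> 2 * e / h"
proof -
  have "\<bar>b - a\<bar> / d \<le> 2 * e / h"
    using assms by (intro frac_le) auto
  then show ?thesis using assms by simp
qed

text \<open>Subtracting the Newton interpolation polynomial leaves a function with three zeros. By
  Rolle's theorem, applied twice, the second derivative somewhere equals twice the divided
  difference.\<close>

lemma divided_difference2:
  fixes f0 f1 f2 :: "real \<Rightarrow> real"
  assumes f1: "\<And>x. (f0 has_real_derivative f1 x) (at x)"
    and f2: "\<And>x. (f1 has_real_derivative f2 x) (at x)"
    and h: "0 < h" "x1 + h \<le> x2" "x2 + h \<le> x3"
    and small: "\<And>x. x \<in> {x1, x2, x3} \<Longrightarrow> \<bar>f0 x\<bar> \<le> e"
  shows "\<exists>z. x1 < z \<and> z < x3 \<and> \<bar>f2 z\<bar> \<le> 8 * e / h ^ 2"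
proof -
  have lt: "x1 < x2" "x2 < x3" using h by linarith+
  define d12 where "d12 = (f0 x2 - f0 x1) / (x2 - x1)"
  define d23 where "d23 = (f0 x3 - f0 x2) / (x3 - x2)"
  define d123 where "d123 = (d23 - d12) / (x3 - x1)"
  have "\<bar>d123\<bar> \<le> 2 * (2 * e / h) / h"
    unfolding d123_def d12_def d23_def
    using h by (intro abs_quotient_le small) auto
  then have d: "\<bar>2 * d123\<bar> \<le> 8 * e / h ^ 2"
    by (simp add: power2_eq_square)
  define g0 where "g0 x = f0 x - (f0 x1 + d12 * (x - x1) + d123 * ((x - x1) * (x - x2)))" for x
  define g1 where "g1 x = f1 x - (d12 + d123 * ((x - x1) + (x - x2)))" for x
  define g2 where "g2 x = f2 x - 2 * d123" for x
  have g1: "(g0 has_real_derivative g1 x) (at x)" for x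
    unfolding g0_def[abs_def] g1_def
    by (rule derivative_eq_intros f1 refl | simp add: algebra_simps)+
  have g2: "(g1 has_real_derivative g2 x) (at x)" for x
    unfolding g1_def[abs_def] g2_def
    by (rule derivative_eq_intros f2 refl | simp)+
  have "g0 x1 = 0" by (simp add: g0_def)
  moreover have z2: "g0 x2 = 0" using lt by (simp add: g0_def d12_def)
  moreover have "g0 x3 = 0"
  proof -
    have "d12 * (x3 - x1) + d123 * ((x3 - x1) * (x3 - x2)) = d12 * (x3 - x1) + (d23 - d12) * (x3 - x2)"
      using lt by (simp add: d123_def)
    also have "\<dots> = d12 * (x2 - x1) + d23 * (x3 - x2)"
      by (simp add: algebra_simps)
    also have "\<dots> = f0 x3 - f0 x1"
      using lt by (simp add: d12_def d23_def)
    finally show ?thesis by (simp add: g0_def)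
  qed
  ultimately obtain y1 y2 where y: "x1 < y1" "y1 < x2" "g1 y1 = 0" "x2 < y2" "y2 < x3" "g1 y2 = 0"
    using MVT2[OF lt(1) g1] MVT2[OF lt(2) g1] lt by auto
  then obtain z where "y1 < z" "z < y2" "g2 z = 0"
    using MVT2[OF _ g2, of y1 y2] by auto
  then show ?thesis
    using y d by (intro exI[of _ z]) (auto simp: g2_def)
qed

text \<open>The same with a cubic interpolant and one more application of Rolle's theorem; its third
  derivative is 6 times the divided difference.\<close>

lemma divided_difference3:
  fixes f0 f1 f2 f3 :: "real \<Rightarrow> real"
  assumes f1: "\<And>x. (f0 has_real_derivative f1 x) (at x)"
    and f2: "\<And>x. (f1 has_real_derivative f2 x) (at x)"
    and f3: "\<And>x. (f2 has_real_derivative f3 x) (at x)"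
    and h: "0 < h" "x1 + h \<le> x2" "x2 + h \<le> x3" "x3 + h \<le> x4"
    and small: "\<And>x. x \<in> {x1, x2, x3, x4} \<Longrightarrow> \<bar>f0 x\<bar> \<le> e"
  shows "\<exists>z. x1 < z \<and> z < x4 \<and> \<bar>f3 z\<bar> \<le> 48 * e / h ^ 3"
proof -
  have lt: "x1 < x2" "x2 < x3" "x3 < x4" using h by linarith+
  define d12 where "d12 = (f0 x2 - f0 x1) / (x2 - x1)"
  define d23 where "d23 = (f0 x3 - f0 x2) / (x3 - x2)"
  define d34 where "d34 = (f0 x4 - f0 x3) / (x4 - x3)"
  define d123 where "d123 = (d23 - d12) / (x3 - x1)"
  define d234 where "d234 = (d34 - d23) / (x4 - x2)"
  define D where "D = (d234 - d123) / (x4 - x1)"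
  have "\<bar>D\<bar> \<le> 2 * (2 * (2 * e / h) / h) / h"
    unfolding D_def d123_def d234_def d12_def d23_def d34_def
    using h by (intro abs_quotient_le small) auto
  then have d: "\<bar>6 * D\<bar> \<le> 48 * e / h ^ 3"
    by (simp add: power3_eq_cube)
  define g0 where "g0 x = f0 x - (f0 x1 + d12 * (x - x1) + d123 * ((x - x1) * (x - x2))
      + D * ((x - x1) * (x - x2) * (x - x3)))" for x
  define g1 where "g1 x = f1 x - (d12 + d123 * ((x - x1) + (x - x2))
      + D * ((x - x2) * (x - x3) + (x - x1) * (x - x3) + (x - x1) * (x - x2)))" for x
  define g2 where "g2 x = f2 x - (2 * d123 + D * (2 * (x - x1) + 2 * (x - x2) + 2 * (x - x3)))" for x
  define g3 where "g3 x = f3 x - 6 * D" for x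
  have g1: "(g0 has_real_derivative g1 x) (at x)" for x
    unfolding g0_def[abs_def] g1_def
    by (rule derivative_eq_intros f1 refl | simp add: algebra_simps)+
  have g2: "(g1 has_real_derivative g2 x) (at x)" for x
    unfolding g1_def[abs_def] g2_def
    by (rule derivative_eq_intros f2 refl | simp add: algebra_simps)+
  have g3: "(g2 has_real_derivative g3 x) (at x)" for x
    unfolding g2_def[abs_def] g3_def
    by (rule derivative_eq_intros f3 refl | simp)+
  have e12: "d12 * (x2 - x1) = f0 x2 - f0 x1" and e23: "d23 * (x3 - x2) = f0 x3 - f0 x2"
    and e34: "d34 * (x4 - x3) = f0 x4 - f0 x3"
    and e123: "d123 * (x3 - x1) = d23 - d12" and e234: "d234 * (x4 - x2) = d34 - d23"
    and e1234: "D * (x4 - x1) = d234 - d123"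
    using lt by (simp_all add: d12_def d23_def d34_def d123_def d234_def D_def)
  have "g0 x1 = 0" by (simp add: g0_def)
  moreover have "g0 x2 = 0" using e12 by (simp add: g0_def)
  moreover have "g0 x3 = 0"
    unfolding g0_def using e12 e23 e123 by simp algebra
  moreover have "g0 x4 = 0"
    unfolding g0_def using e12 e23 e34 e123 e234 e1234 by algebra
  ultimately obtain y1 y2 y3 where y: "x1 < y1" "y1 < x2" "g1 y1 = 0"
    "x2 < y2" "y2 < x3" "g1 y2 = 0" "x3 < y3" "y3 < x4" "g1 y3 = 0"
    using MVT2[OF lt(1) g1] MVT2[OF lt(2) g1] MVT2[OF lt(3) g1] lt by auto
  then obtain z1 z2 where z: "y1 < z1" "z1 < y2" "g2 z1 = 0" "y2 < z2" "z2 < y3" "g2 z2 = 0"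
    using MVT2[OF _ g2, of y1 y2] MVT2[OF _ g2, of y2 y3] by auto
  then obtain w where "z1 < w" "w < z2" "g3 w = 0"
    using MVT2[OF _ g3, of z1 z2] by auto
  then show ?thesis
    using y z d by (intro exI[of _ w]) (auto simp: g3_def)
qed

section \<open>Arcs covering a sublevel set\<close>

lemma arc_shift: "arc (a + 2 * pi * of_int k) (b + 2 * pi * of_int k) = arc a b"
proof -
  have "arc a b \<subseteq> arc (a + 2 * pi * of_int k) (b + 2 * pi * of_int k)" for a b :: real and k
  proof
    fix x assume "x \<in> arc a b"
    then obtain j :: int where "a \<le> x + 2 * pi * of_int j" "x + 2 * pi * of_int j \<le> b"
      by (auto simp: arc_def)
    then show "x \<in> arc (a + 2 * pi * of_int k) (b + 2 * pi * of_int k)"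
      unfolding arc_def by (auto intro!: exI[of _ "j + k"] simp: distrib_left)
  qed
  from this[of a b k] this[of "a + 2 * pi * of_int k" "b + 2 * pi * of_int k" "-k"]
  show ?thesis by auto
qed

lemma arc_add_image: "(\<lambda>x. c + x) ` arc a b = arc (c + a) (c + b)"
proof (intro equalityI subsetI)
  fix x assume "x \<in> arc (c + a) (c + b)"
  then have "x - c \<in> arc a b" by (auto simp: arc_def algebra_simps)
  then show "x \<in> (\<lambda>x. c + x) ` arc a b" by (intro image_eqI[of _ _ "x - c"]) auto
qed (auto simp: arc_def algebra_simps)

lemma arc_diff_image: "(\<lambda>x. c - x) ` arc a b = arc (c - b) (c - a)"
proof -
  have *: "c - x \<in> arc (c - b) (c - a)" if "x \<in> arc a b" for x a b
  proof -
    from that obtain j :: int where "a \<le> x + 2 * pi * of_int j" "x + 2 * pi * of_int j \<le> b"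
      by (auto simp: arc_def)
    then show ?thesis
      unfolding arc_def by (auto intro!: exI[of _ "- j"])
  qed
  show ?thesis
  proof (intro equalityI subsetI)
    fix x assume "x \<in> arc (c - b) (c - a)"
    from *[OF this] show "x \<in> (\<lambda>x. c - x) ` arc a b"
      by (intro image_eqI[of _ _ "c - x"]) auto
  qed (use * in auto)
qed

text \<open>The assumption \<open>seven\<close> says that among any seven consecutive cells \<open>[i \<pi>/n, (i+1) \<pi>/n]\<close> there is
  one on which \<open>\<bar>f\<bar> \<ge> e\<close> throughout.\<close>

locale threshold_cells =
  fixes n :: nat and f :: "real \<Rightarrow> real" and e :: real and d :: nat and P :: "real poly"
  assumes n_gt: "n > 3"
    and cont: "continuous_on UNIV f"
    and f_pi: "f (x + pi) = f x"
    and f_minus: "f (- x) = f x"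
    and f_poly: "(f x)\<^sup>2 - e\<^sup>2 = poly P (cos (2 * x))"
    and deg: "degree P \<le> 2 * d"
    and near_half_pi: "\<bar>x - pi / 2 * of_int m\<bar> \<le> 101 * (pi / real n) \<Longrightarrow> e \<le> \<bar>f x\<bar>"
    and seven: "\<exists>i\<in>{r..<r + 7}. \<forall>x. pi / real n * of_int i \<le> x \<and> x \<le> pi / real n * of_int (i + 1) \<longrightarrow> e \<le> \<bar>f x\<bar>"
begin

section \<open>Bad cells and their maximal runs\<close>

definition h :: real where "h = pi / real n"

definition bad :: "int \<Rightarrow> bool" where
  "bad i \<longleftrightarrow> (\<exists>x. h * of_int i \<le> x \<and> x \<le> h * of_int (i + 1) \<and> \<bar>f x\<bar> < e)"

definition run :: "int \<Rightarrow> int \<Rightarrow> bool" where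
  "run p q \<longleftrightarrow> p < q \<and> (\<forall>r. p \<le> r \<and> r < q \<longrightarrow> bad r) \<and> \<not> bad (p - 1) \<and> \<not> bad q"

definition run_arc :: "int \<times> int \<Rightarrow> real set" where
  "run_arc = (\<lambda>(p, q). arc (h * of_int p) (h * of_int q))"

text \<open>Translates of a run by multiples of \<open>2 * n\<close> cells are different pairs with
  the same arc, so counting needs representatives within one turn.\<close>

definition arcs :: "real set set" where
  "arcs = run_arc ` {(p, q). run p q}"

lemma h_pos: "h > 0"
  using n_gt by (simp add: h_def)

lemma h_n: "h * real n = pi"
  using n_gt by (simp add: h_def)

lemma bad_shift: "bad (i + int n) \<longleftrightarrow> bad i"
proof -
  have eq: "h * of_int (i + int n) = h * of_int i + pi" for i
    using h_n by (simp add: distrib_left)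
  have f': "f (x - pi) = f x" for x
    using f_pi[of "x - pi"] by simp
  show ?thesis
  proof
    assume "bad (i + int n)"
    then obtain x where "h * of_int i + pi \<le> x" "x \<le> h * of_int (i + 1) + pi" "\<bar>f x\<bar> < e"
      unfolding bad_def by (metis eq add.commute add.left_commute)
    then show "bad i"
      unfolding bad_def using f' by (intro exI[of _ "x - pi"]) auto
  next
    assume "bad i"
    then obtain x where "h * of_int i \<le> x" "x \<le> h * of_int (i + 1)" "\<bar>f x\<bar> < e"
      unfolding bad_def by auto
    then show "bad (i + int n)"
      unfolding bad_def using eq[of i] eq[of "i + 1"] f_pi[of x]
      by (intro exI[of _ "x + pi"]) (auto simp: add_ac)
  qed
qed

text \<open>Cells are indexed by their left endpoints, so negation sends cell \<open>i\<close> to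
  cell \<open>- 1 - i\<close>.\<close>

lemma bad_reflect: "bad (- 1 - i) \<longleftrightarrow> bad i"
proof -
  have "bad (- 1 - i)" if "bad i" for i
  proof -
    from that obtain x where "h * of_int i \<le> x" "x \<le> h * of_int (i + 1)" "\<bar>f x\<bar> < e"
      unfolding bad_def by auto
    then show ?thesis
      unfolding bad_def by (intro exI[of _ "- x"]) (simp add: algebra_simps f_minus)
  qed
  from this[of i] this[of "- 1 - i"] show ?thesis by auto
qed

lemma run_add:
  assumes "run p q" shows "run (p + int n) (q + int n)"
proof -
  have "bad r" if "p + int n \<le> r" "r < q + int n" for r
    using that assms bad_shift[of "r - int n"] by (auto simp: run_def)
  moreover have "p + int n - 1 = (p - 1) + int n" by simp
  ultimately show ?thesis
    using assms unfolding run_def by (metis bad_shift add_strict_right_mono)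
qed

lemma run_minus:
  assumes "run p q" shows "run (- q) (- p)"
proof -
  have "bad r" if "- q \<le> r" "r < - p" for r
    using that assms bad_reflect[of r] by (auto simp: run_def)
  moreover have "- q - 1 = - 1 - q" "- p = - 1 - (p - 1)" by simp_all
  then have "\<not> bad (- q - 1)" "\<not> bad (- p)"
    using assms by (simp_all only: bad_reflect run_def not_False_eq_True)
  ultimately show ?thesis
    using assms by (auto simp: run_def)
qed

lemma run_reflect: "run p q \<Longrightarrow> run (int n - q) (int n - p)"
  using run_add[OF run_minus] by fastforce

lemma run_sub:
  assumes "run p q" shows "run (p - int n) (q - int n)"
  \<comment> \<open>Backward translation is forward translation conjugated by negation.\<close>
  using run_minus[OF run_add[OF run_minus[OF assms]]] by (simp add: algebra_simps)

lemma run_shift: "run p q \<Longrightarrow> run (p + int n * k) (q + int n * k)"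
proof (induction k rule: int_induct[of _ 0])
  case (step1 i)
  from run_add[OF step1.IH[OF step1.prems]] show ?case by (simp add: algebra_simps)
next
  case (step2 i)
  from run_sub[OF step2.IH[OF step2.prems]] show ?case by (simp add: algebra_simps)
qed simp

lemma exists_good: "\<exists>i\<in>{r..<r + 7}. \<not> bad i"
  using seven[of r, folded h_def] by (auto simp: bad_def not_less)

lemma run_length: "run p q \<Longrightarrow> q - p \<le> 6"
  using exists_good[of p] by (force simp: run_def)

text \<open>By \<open>exists_good\<close> there are good cells on both sides of \<open>r\<close>;
  the run extends to the nearest ones.\<close>

lemma run_exists:
  assumes "bad r" shows "\<exists>p q. run p q \<and> p \<le> r \<and> r < q"
proof -
  have up: "\<exists>k. \<not> bad (r + int k)"
  proof -
    obtain i where "i \<in> {r..<r + 7}" "\<not> bad i" using exists_good by blast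
    then show ?thesis by (intro exI[of _ "nat (i - r)"]) auto
  qed
  have down: "\<exists>k. \<not> bad (r - int k)"
  proof -
    obtain i where "i \<in> {r - 7..<r - 7 + 7}" "\<not> bad i" using exists_good by blast
    then show ?thesis by (intro exI[of _ "nat (r - i)"]) auto
  qed
  define a where "a = (LEAST k. \<not> bad (r + int k))"
  define b where "b = (LEAST k. \<not> bad (r - int k))"
  have a: "\<not> bad (r + int a)" "\<And>k. k < a \<Longrightarrow> bad (r + int k)"
    unfolding a_def using LeastI_ex[OF up] not_less_Least by blast+
  have b: "\<not> bad (r - int b)" "\<And>k. k < b \<Longrightarrow> bad (r - int k)"
    unfolding b_def using LeastI_ex[OF down] not_less_Least by blast+
  have pos: "a > 0" "b > 0"
    using a(1) b(1) assms by (auto intro: gr0I)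
  have "bad s" if "r - int b + 1 \<le> s" "s < r + int a" for s
    using a(2)[of "nat (s - r)"] b(2)[of "nat (r - s)"] that by (cases "s \<ge> r") auto
  then have "run (r - int b + 1) (r + int a)"
    using a(1) b(1) pos by (auto simp: run_def)
  then show ?thesis
    using pos by (intro exI conjI) auto
qed

text \<open>If \<open>p < p'\<close> and \<open>p' \<le> q\<close>, cell \<open>p' - 1\<close> would
  belong to the first run and be bad, against maximality of the second. The strict inequality leaves
  a whole cell between the runs.\<close>

lemma run_separated:
  assumes "run p q" "run p' q'" "(p, q) \<noteq> (p', q')"
  shows "q < p' \<or> q' < p"
proof -
  have less: "q < p'" if "run p q" "run p' q'" "p < p'" for p q p' q'
  proof (rule ccontr)
    assume "\<not> q < p'"
    then have "bad (p' - 1)" using that by (auto simp: run_def)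
    then show False using that by (simp add: run_def)
  qed
  have False if "p = p'"
    using assms that linorder_less_linear[of q q'] by (auto simp: run_def)
  then show ?thesis
    using less[of p q p' q'] less[of p' q' p q] assms
    by (cases rule: linorder_cases[of p p']) blast+
qed

lemma run_gap:
  assumes "run p q" "run p' q'" "(p, q) \<noteq> (p', q')"
    and x: "h * of_int p \<le> x" "x \<le> h * of_int q" and y: "h * of_int p' \<le> y" "y \<le> h * of_int q'"
  shows "\<bar>x - y\<bar> \<ge> h"
proof -
  have *: "h * of_int a + h \<le> h * of_int b" if "a < b" for a b :: int
  proof -
    have "h * (of_int a + 1) \<le> h * of_int b"
      using that h_pos by (intro mult_left_mono) linarith+
    then show ?thesis by (simp add: distrib_left)
  qed
  from run_separated[OF assms(1-3)] show ?thesis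
  proof
    assume "q < p'"
    with *[of q p'] x y show ?thesis by linarith
  next
    assume "q' < p"
    with *[of q' p] x y show ?thesis by linarith
  qed
qed

lemma run_point_bad:
  assumes "run p q" "h * of_int p \<le> x" "x \<le> h * of_int q"
  obtains r where "p \<le> r" "r < q" "h * of_int r \<le> x" "x \<le> h * of_int (r + 1)" "bad r"
proof (cases "x = h * of_int q")
  \<comment> \<open>The right endpoint of the run belongs to its last cell \<open>q - 1\<close>,
    which rounding down would miss.\<close>
  case True
  have "q - 1 \<ge> p" using assms by (simp add: run_def)
  moreover have "h * of_int (q - 1) = x - h"
    using True by (simp add: right_diff_distrib)
  ultimately show ?thesis
    using True assms h_pos by (intro that[of "q - 1"]) (auto simp: run_def)
next
  case False
  define r where "r = \<lfloor>x / h\<rfloor>"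
  have "p \<le> r"
    unfolding r_def le_floor_iff using assms h_pos by (simp add: pos_le_divide_eq mult.commute)
  moreover have "r < q"
    unfolding r_def floor_less_iff using assms False h_pos by (simp add: pos_divide_less_eq mult.commute)
  moreover have "h * of_int r \<le> x"
    using of_int_floor_le[of "x / h"] h_pos unfolding r_def[symmetric] pos_le_divide_eq[OF h_pos] by (simp only: mult.commute)
  moreover have "x \<le> h * of_int (r + 1)"
    using floor_correct[of "x / h"] unfolding r_def[symmetric] pos_divide_less_eq[OF h_pos]
    by (metis less_imp_le mult.commute)
  ultimately show ?thesis
    using assms by (intro that[of r]) (auto simp: run_def)
qed

text \<open>A point of the run shares a cell with some \<open>y\<close> where \<open>f\<close> is
  small, and such \<open>y\<close> are more than \<open>101 * h\<close> away; the change from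
  \<open>y\<close> to \<open>x\<close> costs at most \<open>h\<close>.\<close>

lemma run_avoids_half_pi:
  assumes "run p q" "h * of_int p \<le> x" "x \<le> h * of_int q"
  shows "\<bar>x - pi / 2 * of_int m\<bar> > 100 * h"
proof -
  obtain r where r: "h * of_int r \<le> x" "x \<le> h * of_int (r + 1)" "bad r"
    using run_point_bad[OF assms] by blast
  then obtain y where y: "h * of_int r \<le> y" "y \<le> h * of_int (r + 1)" "\<bar>f y\<bar> < e"
    unfolding bad_def by blast
  have "h * of_int (r + 1) = h * of_int r + h" by (simp add: distrib_left)
  then have "\<bar>x - y\<bar> \<le> h" using r y by linarith
  moreover have "\<not> \<bar>y - pi / 2 * of_int m\<bar> \<le> 101 * h"
    using near_half_pi[of y m, folded h_def] y by linarith
  ultimately show ?thesis by linarith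
qed

text \<open>A run covers no multiple of pi/2, so it lies between two consecutive ones. Indices are
  doubled because pi/2 is \<open>h * n / 2\<close> and \<open>n\<close> may be odd.\<close>

lemma run_in_quadrant:
  assumes "run p q"
  obtains m where "m * int n < 2 * p" "2 * q < (m + 1) * int n"
proof -
  define m where "m = 2 * p div int n"
  have "0 < int n" using n_gt by simp
  then have "0 \<le> 2 * p mod int n" "2 * p mod int n < int n" by simp_all
  moreover have "m * int n + 2 * p mod int n = 2 * p"
    unfolding m_def by (rule div_mult_mod_eq)
  ultimately have bounds: "m * int n \<le> 2 * p" "2 * p < (m + 1) * int n"
    unfolding distrib_right by linarith+
  have avoid: "\<not> (2 * p \<le> k * int n \<and> k * int n \<le> 2 * q)" for k
  proof
    assume *: "2 * p \<le> k * int n \<and> k * int n \<le> 2 * q"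
    have pk: "pi / 2 * of_int k = h * (of_int (k * int n) / 2)"
      using h_n by (simp add: field_simps)
    have "h * of_int p \<le> pi / 2 * of_int k" "pi / 2 * of_int k \<le> h * of_int q"
      unfolding pk using * h_pos by (intro mult_left_mono; linarith)+
    from run_avoids_half_pi[OF assms this, of k] show False
      using h_pos by simp
  qed
  have "p < q" using assms by (simp add: run_def)
  show ?thesis
    using avoid[of m] avoid[of "m + 1"] bounds \<open>p < q\<close> by (intro that[of m]) linarith+
qed

section \<open>Runs as arcs of the circle\<close>

lemma run_arc_mod: "run_arc (p + int n * (2 * k), q + int n * (2 * k)) = run_arc (p, q)"
proof -
  have "h * of_int (p + int n * (2 * k)) = h * of_int p + 2 * pi * of_int k" for p
    unfolding h_n[symmetric] by (simp add: algebra_simps)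
  then show ?thesis
    by (simp add: run_arc_def arc_shift)
qed

text \<open>A translate of the run by full turns represents the same arc and contains
  \<open>x\<close> on the real line, where the estimates for runs apply.\<close>

lemma run_arcE:
  assumes "x \<in> run_arc (p, q)" "run p q"
  obtains k p' q' where "run p' q'" "run_arc (p', q') = run_arc (p, q)" "p' = p + int n * (2 * k)"
    "h * of_int p' \<le> x" "x \<le> h * of_int q'"
proof -
  obtain k :: int where k: "h * of_int p \<le> x + 2 * pi * of_int k" "x + 2 * pi * of_int k \<le> h * of_int q"
    using assms by (auto simp: run_arc_def arc_def)
  have "h * of_int (p + int n * (2 * (-k))) = h * of_int p - 2 * pi * of_int k" for p
    unfolding h_n[symmetric] by (simp add: algebra_simps)
  then show ?thesis
    using that[OF run_shift[OF assms(2)] run_arc_mod refl, of "- k"] k by auto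
qed

text \<open>Arcs are periodic subsets of the line, so this bound for ordinary distances covers all
  representatives and hence also the circular distance.\<close>

lemma arcs_gap:
  assumes "I \<in> arcs" "J \<in> arcs" "I \<noteq> J" "x \<in> I" "y \<in> J"
  shows "\<bar>x - y\<bar> \<ge> h"
proof -
  obtain p q p' q' where "run p q" "I = run_arc (p, q)" "run p' q'" "J = run_arc (p', q')"
    using assms by (auto simp: arcs_def)
  with assms obtain r s r' s' where "run r s" "I = run_arc (r, s)" "run r' s'" "J = run_arc (r', s')"
    "h * of_int r \<le> x" "x \<le> h * of_int s" "h * of_int r' \<le> y" "y \<le> h * of_int s'"
    by (metis run_arcE)
  with assms(3) show ?thesis
    by (intro run_gap[of r s r' s']) auto
qed

lemma arc_periodic: "x \<in> arc a b \<Longrightarrow> x + 2 * pi * of_int k \<in> arc a b"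
  using arc_add_image[of "2 * pi * of_int k" a b] arc_shift[of a k b] by (auto simp: add.commute)

lemma arcs_invariant:
  assumes "I \<in> arcs"
  shows "(\<lambda>x. pi + x) ` I \<in> arcs" "(\<lambda>x. pi - x) ` I \<in> arcs"
proof -
  obtain p q where pq: "run p q" "I = arc (h * of_int p) (h * of_int q)"
    using assms by (auto simp: arcs_def run_arc_def)
  have "pi + h * of_int p = h * of_int (p + int n)" "pi - h * of_int p = h * of_int (int n - p)" for p
    using h_n by (simp_all add: distrib_left right_diff_distrib)
  then have "(\<lambda>x. pi + x) ` I = run_arc (p + int n, q + int n)"
    "(\<lambda>x. pi - x) ` I = run_arc (int n - q, int n - p)"
    unfolding pq arc_add_image arc_diff_image run_arc_def by auto
  then show "(\<lambda>x. pi + x) ` I \<in> arcs" "(\<lambda>x. pi - x) ` I \<in> arcs"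
    unfolding arcs_def using run_add[OF pq(1)] run_reflect[OF pq(1)] by auto
qed

lemma arcs_is_arc:
  assumes "I \<in> arcs"
  obtains p q where "is_arc I (h * of_int p) (h * of_int q)" "h * of_int q - h * of_int p \<le> 6 * pi / real n"
proof -
  obtain p q where pq: "run p q" "I = arc (h * of_int p) (h * of_int q)"
    using assms by (auto simp: arcs_def run_arc_def)
  have "h * of_int q - h * of_int p = h * of_int (q - p)"
    by (simp add: right_diff_distrib)
  also have "\<dots> \<le> h * 6"
    using run_length[OF pq(1)] h_pos by (intro mult_left_mono) linarith+
  finally have le: "h * of_int q - h * of_int p \<le> 6 * pi / real n" by (simp add: h_def mult.commute)
  \<comment> \<open>This is where \<open>n > 3\<close> is used: a run is shorter than a full
    turn.\<close>
  have "6 * pi / real n < 2 * pi"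
    using n_gt by (simp add: divide_less_eq)
  moreover have "h * of_int p < h * of_int q"
    using pq(1) h_pos by (intro mult_strict_left_mono) (auto simp: run_def)
  ultimately show ?thesis
    using le pq(2) by (intro that[of p q]) (auto simp: is_arc_def)
qed

lemma suitable_arcs: "suitable n arcs"
  unfolding suitable_def
proof (intro conjI ballI impI)
  fix I assume "I \<in> arcs"
  then show "\<exists>a b. is_arc I a b \<and> (\<exists>p::int. a = pi / real n * of_int p) \<and> (\<exists>q::int. b = pi / real n * of_int q)"
    unfolding h_def[symmetric] by (metis arcs_is_arc)
next
  fix I J assume "I \<in> arcs" "J \<in> arcs" "I \<noteq> J"
  then show "I \<inter> J = {}"
    using arcs_gap[of I J] h_pos by force
qed (auto simp: arcs_invariant)

lemma well_separated_arcs: "well_separated n arcs"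
  unfolding well_separated_def
proof (intro conjI ballI impI allI)
  fix I assume "I \<in> arcs"
  then show "\<exists>a b. is_arc I a b \<and> b - a \<le> 6 * pi / real n"
    by (metis arcs_is_arc)
next
  fix I J assume IJ: "I \<in> arcs" "J \<in> arcs" "I \<noteq> J"
  have per: "x + 2 * pi * of_int k \<in> I" if "x \<in> I" for x k
    using that IJ(1) arc_periodic by (auto simp: arcs_def run_arc_def)
  have ne: "\<exists>x. x \<in> I" if I: "I \<in> arcs" for I
  proof -
    obtain p q where "is_arc I (h * of_int p) (h * of_int q)" "h * of_int q - h * of_int p \<le> 6 * pi / real n"
      by (rule arcs_is_arc[OF I])
    then have "h * of_int p \<in> I"
      by (auto simp: is_arc_def arc_def intro!: exI[of _ 0])
    then show ?thesis ..
  qed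
  have "circ_dist x y \<ge> h" if "x \<in> I" "y \<in> J" for x y
    unfolding circ_dist_def
  proof (rule cInf_greatest)
    fix z assume "z \<in> {\<bar>x - y + 2 * pi * of_int k\<bar> | k::int. True}"
    then obtain k :: int where "z = \<bar>(x + 2 * pi * of_int k) - y\<bar>"
      by (auto simp: algebra_simps)
    then show "h \<le> z"
      using arcs_gap[OF IJ per[OF \<open>x \<in> I\<close>] \<open>y \<in> J\<close>] by auto
  qed auto
  moreover obtain x y where "x \<in> I" "y \<in> J" using ne IJ by blast
  ultimately show "Inf {circ_dist x y | x y. x \<in> I \<and> y \<in> J} \<ge> pi / real n"
    unfolding h_def[symmetric] by (intro cInf_greatest) auto
next
  fix x and m :: int assume "x \<in> \<Union>arcs"
  then obtain p q where "run p q" "h * of_int p \<le> x" "x \<le> h * of_int q"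
    unfolding arcs_def by (auto elim: run_arcE)
  from run_avoids_half_pi[OF this, of m] show "\<bar>x - pi / 2 * of_int m\<bar> > 100 * pi / real n"
    by (simp add: h_def)
qed

lemma outside_arcs:
  assumes "x \<notin> \<Union>arcs" shows "e \<le> \<bar>f x\<bar>"
proof (rule ccontr)
  assume "\<not> e \<le> \<bar>f x\<bar>"
  define r where "r = \<lfloor>x / h\<rfloor>"
  have r: "h * of_int r \<le> x" "x \<le> h * of_int (r + 1)"
    using floor_correct[of "x / h"] unfolding r_def[symmetric] pos_divide_less_eq[OF h_pos] pos_le_divide_eq[OF h_pos]
    by (auto simp: mult.commute)
  with \<open>\<not> e \<le> \<bar>f x\<bar>\<close> have "bad r" unfolding bad_def by auto
  then obtain p q where pq: "run p q" "p \<le> r" "r < q" using run_exists by blast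
  have "h * of_int p \<le> h * of_int r" "h * of_int (r + 1) \<le> h * of_int q"
    using pq h_pos by (intro mult_left_mono; linarith)+
  then have "x \<in> run_arc (p, q)"
    using r by (auto simp: run_arc_def arc_def intro!: exI[of _ 0])
  then show False using assms pq by (auto simp: arcs_def)
qed

section \<open>Counting the arcs by quadrants\<close>

definition quadrant_runs :: "int \<Rightarrow> (int \<times> int) set" where
  "quadrant_runs m = {(p, q). run p q \<and> m * int n < 2 * p \<and> 2 * q < (m + 1) * int n}"

lemma finite_quadrant_runs: "finite (quadrant_runs m)"
proof (rule finite_subset)
  show "quadrant_runs m \<subseteq> {- \<bar>(m + 1) * int n\<bar> - \<bar>m * int n\<bar> .. \<bar>(m + 1) * int n\<bar> + \<bar>m * int n\<bar>} \<times>
      {- \<bar>(m + 1) * int n\<bar> - \<bar>m * int n\<bar> .. \<bar>(m + 1) * int n\<bar> + \<bar>m * int n\<bar>}"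
    unfolding quadrant_runs_def run_def by (auto simp only: split: prod.splits; fastforce)
qed auto

lemma card_quadrant_runs_reflect: "card (quadrant_runs 1) = card (quadrant_runs 0)"
  by (rule bij_betw_same_card[of "\<lambda>(p, q). (int n - q, int n - p)"],
      rule bij_betw_byWitness[where f' = "\<lambda>(p, q). (int n - q, int n - p)"])
    (auto simp: quadrant_runs_def dest: run_reflect)

lemma card_quadrant_runs_shift: "card (quadrant_runs (m + 2)) = card (quadrant_runs m)"
  by (rule bij_betw_same_card[of "\<lambda>(p, q). (p - int n, q - int n)"],
      rule bij_betw_byWitness[where f' = "\<lambda>(p, q). (p + int n, q + int n)"])
    (auto simp: quadrant_runs_def algebra_simps dest: run_add run_sub)

lemma card_UN_quadrant_runs: "card (\<Union>m\<in>{0..<4}. quadrant_runs m) = 4 * card (quadrant_runs 0)"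
proof -
  have "quadrant_runs i \<inter> quadrant_runs j = {}" if "i < j" for i j
  proof -
    have "(i + 1) * int n \<le> j * int n" using that by (intro mult_right_mono) auto
    then show ?thesis by (fastforce simp: quadrant_runs_def run_def)
  qed
  then have "quadrant_runs i \<inter> quadrant_runs j = {}" if "i \<noteq> j" for i j
    using that by (metis inf_commute linorder_neqE)
  then have "card (\<Union>m\<in>{0..<4}. quadrant_runs m) = (\<Sum>m\<in>{0..<4}. card (quadrant_runs m))"
    using finite_quadrant_runs by (intro card_UN_disjoint) auto
  also have "\<dots> = (\<Sum>m\<in>{0, 1, 2, 3}. card (quadrant_runs m))"
    by (intro sum.cong) auto
  also have "\<dots> = 4 * card (quadrant_runs 0)"
    using card_quadrant_runs_shift[of 0] card_quadrant_runs_shift[of 1] card_quadrant_runs_reflect by simp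
  finally show ?thesis .
qed

lemma arcs_eq: "arcs = run_arc ` (\<Union>m\<in>{0..<4}. quadrant_runs m)"
proof
  show "arcs \<subseteq> run_arc ` (\<Union>m\<in>{0..<4}. quadrant_runs m)"
  proof
    fix I assume "I \<in> arcs"
    then obtain p q where pq: "run p q" "I = run_arc (p, q)" by (auto simp: arcs_def)
    obtain m where m: "m * int n < 2 * p" "2 * q < (m + 1) * int n"
      using run_in_quadrant[OF pq(1)] .
    \<comment> \<open>A full turn is \<open>2 * n\<close> cells, or four quadrants, so translation
      by \<open>k\<close> turns changes the quadrant index by \<open>4 * k\<close>.\<close>
    define k where "k = - (m div 4)"
    have "m mod 4 = m + 4 * k"
      unfolding k_def by (simp add: minus_mult_div_eq_mod[symmetric])
    then have "(p + int n * (2 * k), q + int n * (2 * k)) \<in> quadrant_runs (m mod 4)"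
      using m run_shift[OF pq(1), of "2 * k"] by (auto simp: quadrant_runs_def algebra_simps)
    moreover have "m mod 4 \<in> {0..<4}" by simp
    ultimately show "I \<in> run_arc ` (\<Union>m\<in>{0..<4}. quadrant_runs m)"
      unfolding pq(2) run_arc_mod[of p k q, symmetric] by (intro imageI UN_I)
  qed
qed (auto simp: arcs_def quadrant_runs_def)

text \<open>If two runs have the same arc, a translate of one by full turns meets the other and so
  coincides with it by \<open>run_gap\<close>. Both start in the range from 0 to
  \<open>2 * n\<close>, exclusive of \<open>2 * n\<close>, so the translation is zero.\<close>

lemma inj_on_run_arc: "inj_on run_arc (\<Union>m\<in>{0..<4}. quadrant_runs m)"
proof (rule inj_onI)
  fix u v assume u: "u \<in> (\<Union>m\<in>{0..<4}. quadrant_runs m)" and v: "v \<in> (\<Union>m\<in>{0..<4}. quadrant_runs m)"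
    and eq: "run_arc u = run_arc v"
  have *: "run p q \<and> 0 \<le> p \<and> p < 2 * int n" if "(p, q) \<in> (\<Union>m\<in>{0..<4}. quadrant_runs m)" for p q
  proof -
    from that obtain m where m: "0 \<le> m" "m + 1 \<le> 4" "run p q" "m * int n < 2 * p" "2 * q < (m + 1) * int n"
      by (auto simp: quadrant_runs_def)
    have "0 \<le> m * int n" "(m + 1) * int n \<le> 4 * int n"
      using m by (auto intro: mult_right_mono)
    moreover have "p < q" using m by (simp add: run_def)
    ultimately show ?thesis using m by (intro conjI) linarith+
  qed
  obtain p q p' q' where uv: "u = (p, q)" "v = (p', q')" by fastforce
  have ru: "run p q" "0 \<le> p" "p < 2 * int n" and rv: "run p' q'" "0 \<le> p'" "p' < 2 * int n"
    using * u v uv by auto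
  have "h * of_int p \<in> run_arc (p, q)"
    using ru h_pos by (auto simp: run_arc_def arc_def run_def intro!: exI[of _ 0] divide_right_mono)
  then have "h * of_int p \<in> run_arc (p', q')" using eq uv by simp
  then obtain k r s where r: "run r s" "r = p' + int n * (2 * k)"
      "h * of_int r \<le> h * of_int p" "h * of_int p \<le> h * of_int s"
    using rv(1) by (elim run_arcE) auto
  have "h * of_int p \<le> h * of_int q"
    using ru h_pos by (intro mult_left_mono) (auto simp: run_def)
  then have "(r, s) = (p, q)"
    using run_gap[OF r(1) ru(1), of "h * of_int p" "h * of_int p"] r h_pos by force
  with r have p_eq: "p = p' + 2 * int n * k" by simp
  moreover have "\<bar>p - p'\<bar> < 2 * int n" using ru rv by linarith
  ultimately have "\<bar>2 * int n * k\<bar> < 2 * int n" by simp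
  then have "2 * int n * \<bar>k\<bar> < 2 * int n * 1" by (simp add: abs_mult)
  then have "k = 0" using n_gt by (simp only: mult_less_cancel_left) auto
  then have "p = p'" using p_eq by simp
  then show "u = v"
    using run_separated[OF ru(1) rv(1)] uv ru(1) rv(1) by (auto simp: run_def)
qed

lemma card_arcs: "finite arcs" "card arcs = 4 * card (quadrant_runs 0)"
  using finite_quadrant_runs card_image[OF inj_on_run_arc]
  by (simp_all add: arcs_eq card_UN_quadrant_runs)

text \<open>The endpoints of a run also belong to the good neighbouring cells, so \<open>g\<close>
  is nonnegative there, while it is negative somewhere inside. The intermediate value theorem gives
  a zero on each side.\<close>

lemma run_crossings:
  assumes "run p q"
  obtains y z where "h * of_int p \<le> y" "y < z" "z \<le> h * of_int q" "(f y)\<^sup>2 - e\<^sup>2 = 0" "(f z)\<^sup>2 - e\<^sup>2 = 0"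
    "P \<noteq> 0"
proof -
  define g where "g x = (f x)\<^sup>2 - e\<^sup>2" for x
  have contg: "continuous_on A g" for A
    unfolding g_def[abs_def] using cont by (intro continuous_intros) (auto intro: continuous_on_subset)
  have "bad p" "p < q" using assms by (auto simp: run_def)
  then obtain x where x: "h * of_int p \<le> x" "x \<le> h * of_int (p + 1)" "\<bar>f x\<bar> < e"
    unfolding bad_def by blast
  have "h * of_int (p + 1) \<le> h * of_int q"
    using h_pos \<open>p < q\<close> by (intro mult_left_mono) linarith+
  with x have xq: "x \<le> h * of_int q" by linarith
  have neg: "g x < 0"
    using power_strict_mono[OF x(3), of 2] by (simp add: g_def)
  have pos: "0 \<le> g y" if "e \<le> \<bar>f y\<bar>" for y
    using power_mono[OF that, of 2] x(3) by (simp add: g_def)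
  have "\<not> bad (p - 1)" "\<not> bad q" using assms by (auto simp: run_def)
  moreover have "h * of_int (p - 1) \<le> h * of_int p" "h * of_int q \<le> h * of_int (q + 1)"
    using h_pos by (intro mult_left_mono; simp)+
  ultimately have "0 \<le> g (h * of_int p)" "0 \<le> g (h * of_int q)"
    by (intro pos; force simp: bad_def not_less)+
  with neg x(1) xq obtain y z where yz: "h * of_int p \<le> y" "y \<le> x" "g y = 0" "x \<le> z" "z \<le> h * of_int q" "g z = 0"
    using IVT2'[of g x 0 "h * of_int p"] IVT'[of g x 0 "h * of_int q"] contg by (metis less_imp_le)
  moreover have "y \<noteq> x" using yz neg by auto
  moreover have "P \<noteq> 0" using neg f_poly[of x] by (auto simp: g_def)
  ultimately show ?thesis
    by (intro that[of y z]) (auto simp: g_def)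
qed

text \<open>Every run in the first quadrant contributes at least two of the at most \<open>2 d\<close> roots of \<open>P\<close>.\<close>

lemma card_quadrant_runs_le: "card (quadrant_runs 0) \<le> d"
proof (cases "quadrant_runs 0 = {}")
  case False
  then have P: "P \<noteq> 0"
    by (auto simp: quadrant_runs_def elim: run_crossings)
  define Z where "Z = (\<lambda>(p, q). {w. poly P w = 0 \<and> (\<exists>x. h * of_int p \<le> x \<and> x \<le> h * of_int q \<and> w = cos (2 * x))})"
  \<comment> \<open>In the first quadrant \<open>2 * x\<close> stays in the interval from 0 to pi,
    where cosine is injective, so different crossings give different roots.\<close>
  have range: "0 \<le> 2 * x \<and> 2 * x \<le> pi" if "(p, q) \<in> quadrant_runs 0" "h * of_int p \<le> x" "x \<le> h * of_int q" for p q x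
  proof -
    have "0 \<le> h * of_int p" "h * of_int (2 * q) \<le> h * real n"
      using that h_pos by (intro mult_nonneg_nonneg mult_left_mono; force simp: quadrant_runs_def)+
    then show ?thesis using that h_n by simp
  qed
  have fin: "finite (Z u)" for u
    using poly_roots_finite[OF P] by (auto simp: Z_def split: prod.splits)
  have two: "2 \<le> card (Z u)" if mem: "u \<in> quadrant_runs 0" for u
  proof -
    obtain p q where u: "u = (p, q)" "run p q" using mem by (cases u) (auto simp: quadrant_runs_def)
    from u(2) obtain y z where yz: "h * of_int p \<le> y" "y < z" "z \<le> h * of_int q"
        "(f y)\<^sup>2 - e\<^sup>2 = 0" "(f z)\<^sup>2 - e\<^sup>2 = 0"
      by (rule run_crossings)
    have "poly P (cos (2 * y)) = 0" "poly P (cos (2 * z)) = 0"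
      using yz f_poly[of y] f_poly[of z] by simp_all
    then have "{cos (2 * y), cos (2 * z)} \<subseteq> Z u"
      unfolding Z_def u(1) using yz by (auto intro: exI[of _ y] exI[of _ z])
    moreover have "cos (2 * z) < cos (2 * y)"
      using yz range[of p q y] range[of p q z] mem u by (intro cos_monotone_0_pi) auto
    ultimately show ?thesis
      using card_mono[OF fin, of "{cos (2 * y), cos (2 * z)}" u] by simp
  qed
  have disj: "Z u \<inter> Z v = {}" if "u \<in> quadrant_runs 0" "v \<in> quadrant_runs 0" "u \<noteq> v" for u v
  proof (rule ccontr)
    assume "Z u \<inter> Z v \<noteq> {}"
    obtain p q p' q' where uv: "u = (p, q)" "v = (p', q')" by fastforce
    with \<open>Z u \<inter> Z v \<noteq> {}\<close> obtain x y where xy: "h * of_int p \<le> x" "x \<le> h * of_int q"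
        "h * of_int p' \<le> y" "y \<le> h * of_int q'" "cos (2 * x) = cos (2 * y)"
      by (auto simp: Z_def)
    have "0 \<le> 2 * x \<and> 2 * x \<le> pi" "0 \<le> 2 * y \<and> 2 * y \<le> pi"
      using range[of p q x] range[of p' q' y] xy that uv by blast+
    then have "2 * x = 2 * y"
      using xy(5) by (metis cos_inj_pi)
    moreover have "\<bar>x - y\<bar> \<ge> h"
      using that uv xy by (intro run_gap[of p q p' q']) (auto simp: quadrant_runs_def)
    ultimately show False using h_pos by simp
  qed
  have "2 * card (quadrant_runs 0) = (\<Sum>u\<in>quadrant_runs 0. 2)" by simp
  also have "\<dots> \<le> (\<Sum>u\<in>quadrant_runs 0. card (Z u))"
    by (intro sum_mono two)
  also have "\<dots> = card (\<Union>u\<in>quadrant_runs 0. Z u)"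
    using finite_quadrant_runs fin disj by (subst card_UN_disjoint) auto
  also have "\<dots> \<le> card {w. poly P w = 0}"
    by (intro card_mono poly_roots_finite P) (auto simp: Z_def)
  also have "\<dots> \<le> degree P"
    by (rule card_poly_roots_bound[OF P])
  finally show ?thesis using deg by simp
qed simp

lemma suitable_card_arcs:
  assumes "real d \<le> g * real n" shows "suitable_card n g arcs"
  unfolding suitable_card_def using card_arcs card_quadrant_runs_le assms by force

end

section \<open>The sublevel sets of the cosine polynomial\<close>

lemma rsF_lipschitz: "\<bar>rsF t j x - rsF t j y\<bar> \<le> 2 * 3 ^ Suc j * rsM t * \<bar>x - y\<bar>"
  using field_differentiable_bound[of UNIV "rsF t j" "rsF t (Suc j)" "2 * 3 ^ Suc j * rsM t" x y]
    rsF_deriv[of t j] abs_rsF_le[of t "Suc j"]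
  by (auto simp: real_norm_def)

text \<open>Divided differences make each derivative of order up to 3 small at some point of a
  window of length at most \<open>7 * h\<close>. The Lipschitz bound carries orders 0 to 2 over to
  the point \<open>z3\<close> of the third, contradicting \<open>rsF_nondegenerate\<close>.\<close>

lemma rsF_not_four_small:
  assumes h: "0 < h" "h \<le> 1 / 10 ^ 6"
    and gap: "x1 + h \<le> x2" "x2 + h \<le> x3" "x3 + h \<le> x4" "x4 - x1 \<le> 7 * h"
    and e: "e \<le> h ^ 3 * rsM t / 200"
    and small: "\<And>x. x \<in> {x1, x2, x3, x4} \<Longrightarrow> \<bar>rsF t 0 x\<bar> \<le> e"
  shows False
proof -
  let ?M = "rsM t"
  have M: "?M > 0" by simp
  obtain z1 where z1: "x1 < z1" "z1 < x2" "\<bar>rsF t 1 z1\<bar> \<le> 2 * e / h"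
    using divided_difference1[of "rsF t 0" "rsF t 1" h x1 x2 e] rsF_deriv[of t 0] h gap small by auto
  obtain z2 where z2: "x1 < z2" "z2 < x3" "\<bar>rsF t 2 z2\<bar> \<le> 8 * e / h ^ 2"
    using divided_difference2[of "rsF t 0" "rsF t 1" "rsF t 2" h x1 x2 x3 e]
      rsF_deriv[of t 0] rsF_deriv[of t 1] h gap small by (auto simp: numeral_2_eq_2)
  obtain z3 where z3: "x1 < z3" "z3 < x4" "\<bar>rsF t 3 z3\<bar> \<le> 48 * e / h ^ 3"
    using divided_difference3[of "rsF t 0" "rsF t 1" "rsF t 2" "rsF t 3" h x1 x2 x3 x4 e]
      rsF_deriv[of t 0] rsF_deriv[of t 1] rsF_deriv[of t 2] h gap small
    by (auto simp: numeral_2_eq_2 numeral_3_eq_3)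
  have hM: "0 \<le> h * ?M" "h * ?M \<le> ?M / 1000000"
    using h M mult_right_mono[OF h(2), of ?M] by auto
  have h1: "h ^ Suc k * ?M \<le> h * ?M" for k
    using power_decreasing[of 1 "Suc k" h] h by (intro mult_right_mono) auto
  have b0: "e \<le> h * ?M"
    using e h1[of 2] hM by (simp add: numeral_3_eq_3)
  \<comment> \<open>Orders 1 and 2 keep a positive power of \<open>h\<close> and become tiny. Order
    3 loses all of them and only gives 48/200, which is still below 1/4.\<close>
  have "2 * e / h \<le> 2 * (h ^ 3 * ?M / 200) / h"
    using e h by (intro divide_right_mono) auto
  then have "2 * e / h \<le> h ^ Suc 1 * ?M / 100"
    using h by (simp add: power3_eq_cube power2_eq_square)
  then have b1: "2 * e / h \<le> h * ?M"
    using h1[of 1] hM by linarith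
  have "8 * e / h ^ 2 \<le> 8 * (h ^ 3 * ?M / 200) / h ^ 2"
    using e h by (intro divide_right_mono) auto
  then have "8 * e / h ^ 2 \<le> h * ?M / 25"
    using h by (simp add: power3_eq_cube power2_eq_square)
  then have b2: "8 * e / h ^ 2 \<le> h * ?M"
    using hM by linarith
  have "48 * e / h ^ 3 \<le> 48 * (h ^ 3 * ?M / 200) / h ^ 3"
    using e h by (intro divide_right_mono) auto
  moreover have "48 * (h ^ 3 * ?M / 200) / h ^ 3 = 6 * ?M / 25"
    using h by simp
  ultimately have b3: "48 * e / h ^ 3 \<le> ?M / 4"
    using M by linarith
  \<comment> \<open>The constant 378 is 2 * 27 * 7: the bound on the next derivative times the
    length of the window.\<close>
  have lip: "\<bar>rsF t j z3\<bar> \<le> \<bar>rsF t j z\<bar> + 378 * (h * ?M)" if "j \<le> 2" "x1 \<le> z" "z \<le> x4" for j z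
  proof -
    have "\<bar>z3 - z\<bar> \<le> 7 * h" using that z3 gap by linarith
    moreover have "(3::real) ^ Suc j \<le> 3 ^ 3" using that by (intro power_increasing) auto
    ultimately have "2 * 3 ^ Suc j * ?M * \<bar>z3 - z\<bar> \<le> 2 * 3 ^ 3 * ?M * (7 * h)"
      using M h by (intro mult_mono) auto
    with rsF_lipschitz[of t j z3 z] have "\<bar>rsF t j z3 - rsF t j z\<bar> \<le> 2 * 3 ^ 3 * ?M * (7 * h)"
      by (rule order_trans)
    also have "\<dots> = 378 * (h * ?M)" by simp
    finally show ?thesis by linarith
  qed
  have "\<bar>rsF t 0 z3\<bar> \<le> 379 * (h * ?M)"
    using lip[of 0 x1] small[of x1] b0 gap h by simp
  moreover have "\<bar>rsF t 1 z3\<bar> \<le> 379 * (h * ?M)"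
    using lip[of 1 z1] z1 b1 gap h by simp
  moreover have "\<bar>rsF t 2 z3\<bar> \<le> 379 * (h * ?M)"
    using lip[of 2 z2] z2 b2 gap h by simp
  moreover have "\<bar>rsF t 3 z3\<bar> \<le> ?M / 4"
    using z3 b3 by simp
  moreover have "379 * (h * ?M) \<le> ?M / 64" using hM M by linarith
  ultimately show False
    using rsF_nondegenerate[of t z3] by linarith
qed

text \<open>These are the Chebyshev polynomials, built from cos((m+2)x) = 2 cos x cos((m+1)x) -
  cos(m x).\<close>

lemma cos_poly: "\<exists>p::real poly. degree p \<le> k \<and> (\<forall>x. cos (real k * x) = poly p (cos x))"
proof (induction k rule: less_induct)
  case (less k)
  consider "k = 0" | "k = 1" | m where "k = Suc (Suc m)"
    by (metis One_nat_def old.nat.exhaust)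
  then show ?case
  proof cases
    case 1
    then show ?thesis by (intro exI[of _ 1]) auto
  next
    case 2
    then show ?thesis by (intro exI[of _ "[:0, 1:]"]) auto
  next
    case 3
    obtain p q where p: "degree p \<le> m" "\<And>x. cos (real m * x) = poly p (cos x)"
      and q: "degree q \<le> Suc m" "\<And>x. cos (real (Suc m) * x) = poly q (cos x)"
      using less[of m] less[of "Suc m"] 3 by auto
    have "cos (real k * x) = poly ([:0, 2:] * q - p) (cos x)" for x
    proof -
      have "cos (real k * x) + cos (real m * x) = 2 * cos x * cos (real (Suc m) * x)"
        unfolding cos_plus_cos using 3 by (simp add: algebra_simps add_divide_distrib)
      then show ?thesis using p q by simp
    qed
    moreover have "degree ([:0, 2:] * q - p) \<le> k"
      using degree_mult_le[of "[:0, 2:]" q] p q 3 by (intro degree_diff_le) auto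
    ultimately show ?thesis by blast
  qed
qed

lemma cospoly_as_poly:
  assumes "\<And>k. k \<in> Cprime t \<Longrightarrow> k \<le> d"
  shows "\<exists>p. degree p \<le> d \<and> (\<forall>x. cospoly e (Cset t) x = poly p (cos (2 * x)))"
proof -
  obtain c :: "nat \<Rightarrow> real poly" where c: "\<And>k. degree (c k) \<le> k" "\<And>k x. cos (real k * x) = poly (c k) (cos x)"
    using cos_poly by metis
  have "degree (\<Sum>k\<in>Cprime t. smult (e (2 * k)) (c k)) \<le> d"
  proof (intro degree_sum_le)
    show "finite (Cprime t)" by (simp add: Cprime_def)
    show "degree (smult (e (2 * k)) (c k)) \<le> d" if "k \<in> Cprime t" for k
      using degree_smult_le c(1) assms[OF that] by (metis order_trans)
  qed
  then show ?thesis
    by (intro exI conjI) (auto simp: cospoly_double c(2) poly_sum)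
qed

lemma cospoly_add_pi: "cospoly e (Cset t) (x + pi) = cospoly e (Cset t) x"
proof -
  have "cos (real k * (2 * (x + pi))) = cos (real k * (2 * x))" for k
  proof -
    have "real k * (2 * (x + pi)) = real k * (2 * x) + of_nat k * (2 * pi)"
      by (simp add: algebra_simps)
    then show ?thesis
      using cos.plus_of_nat[of "real k * (2 * x)" k] by simp
  qed
  then show ?thesis by (simp only: cospoly_double)
qed

text \<open>Of the exponent 7/2, the power 3 matches the cube of the rescaled cell width
  \<open>h\<close>, and the remaining \<open>sqrt g\<close> combines with \<open>sqrt n\<close> into
  a multiple of \<open>sqrt T\<close>.\<close>

lemma threshold_le:
  fixes g T h n :: real
  assumes "n > 0" "T \<ge> 1" "0 < g" and gn: "g * n = 2049 * T - 1" and h: "h = 2048 * T * (pi / n)"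
  shows "2 powr (-8) * g powr (7/2) * sqrt n \<le> h ^ 3 * sqrt (2 * T) / 200"
proof -
  \<comment> \<open>The factor 2.99 leaves room to replace 2049 by 2048 and pi by 3.\<close>
  have "2.99 * (g * n) \<le> 2048 * T * 3"
    unfolding gn using assms by simp
  also have "\<dots> \<le> 2048 * T * pi"
    using pi_gt3 assms by (intro mult_left_mono) auto
  finally have gh: "2.99 * g \<le> h"
    unfolding h using assms by (simp add: field_simps)
  have "g powr (7/2) = g powr (3 + 1/2)" by simp
  also have "\<dots> = g ^ 3 * sqrt g"
    using assms by (simp only: powr_add powr_half_sqrt powr_numeral)
  finally have "2 powr (-8) * g powr (7/2) * sqrt n = g ^ 3 * sqrt (g * n) / 256"
    by (simp add: real_sqrt_mult powr_minus)
  \<comment> \<open>The numerical facts are 2049 <= 2 * 33^2 and, further below, 33/256 <=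
    2.99^3/200.\<close>
  also have "sqrt (g * n) \<le> 33 * sqrt (2 * T)"
  proof -
    have "sqrt (g * n) \<le> sqrt (33\<^sup>2 * (2 * T))"
      unfolding gn using assms by (intro real_sqrt_le_mono) simp
    then show ?thesis by (simp only: real_sqrt_mult[of "33\<^sup>2"] real_sqrt_abs abs_numeral)
  qed
  then have "g ^ 3 * sqrt (g * n) / 256 \<le> g ^ 3 * (33 * sqrt (2 * T)) / 256"
    using assms by (intro divide_right_mono mult_left_mono) auto
  also have "\<dots> \<le> (2.99 * g) ^ 3 * sqrt (2 * T) / 200"
    using assms by (simp add: power_mult_distrib power3_eq_cube)
  also have "\<dots> \<le> h ^ 3 * sqrt (2 * T) / 200"
    using gh assms by (intro divide_right_mono mult_right_mono power_mono) auto
  finally show ?thesis .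
qed

lemma threshold_cells_rs:
  assumes "n > 0" "odd t" and g: "0 < g" "g \<le> 2 powr (-40)" and gn: "g * real n = 2049 * 2 ^ t - 1"
    and e: "e = 2 powr (-8) * g powr (7/2) * sqrt (real n)"
  shows "\<exists>P. threshold_cells n (cospoly (rs_eps t) (Cset t)) e (2049 * 2 ^ t - 1) P"
proof -
  let ?f = "cospoly (rs_eps t) (Cset t)" and ?T = "2 ^ t :: real" and ?M = "rsM t"
  define h where "h = 2048 * ?T * (pi / real n)"
  have T: "?T \<ge> 1" and M: "?M > 0" by simp_all
  have eh: "e \<le> h ^ 3 * ?M / 200"
    unfolding e by (rule threshold_le) (use assms h_def in auto)
  have h_pos: "h > 0" using assms by (simp add: h_def)
  have "2048 * ?T * pi \<le> g * real n * 4"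
    using pi_less_4 pi_gt_zero T unfolding gn by (intro mult_mono) linarith+
  then have "h \<le> 4 * g"
    using assms by (simp add: h_def field_simps)
  moreover have "(2::real) powr (-40) = 1 / 2 ^ 40"
    by (simp add: powr_minus)
  ultimately have h_le: "h \<le> 1 / 10 ^ 6" using g by simp
  have scale: "2048 * ?T * (a * (pi / real n)) = a * h" for a
    by (simp add: h_def)
  have cell: "\<bar>2048 * ?T * x - 2048 * ?T * y\<bar> \<le> a * h" if "\<bar>x - y\<bar> \<le> a * (pi / real n)" for x y a
  proof -
    have "2048 * ?T * \<bar>x - y\<bar> \<le> 2048 * ?T * (a * (pi / real n))"
      using that by (intro mult_left_mono) auto
    then show ?thesis
      unfolding scale right_diff_distrib[symmetric] abs_mult by simp
  qed
  obtain Q where Q: "degree Q \<le> 2049 * 2 ^ t - 1" "\<And>x. ?f x = poly Q (cos (2 * x))"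
  proof -
    have "k \<le> 2049 * 2 ^ t - 1" if "k \<in> Cprime t" for k
      using that by (auto simp: Cprime_def power_add)
    from that cospoly_as_poly[OF this] show ?thesis by blast
  qed
  show ?thesis
  proof (intro exI[of _ "Q\<^sup>2 - [:e\<^sup>2:]"] threshold_cells.intro)
    show "n > 3"
    proof -
      have "2048 * 1 \<le> 2049 * ?T - 1" using T by linarith
      also have "\<dots> \<le> 1 * real n"
        unfolding gn[symmetric] using g \<open>2 powr (-40) = 1 / 2 ^ 40\<close> by (intro mult_right_mono) auto
      finally show ?thesis by simp
    qed
    show "continuous_on UNIV ?f"
      unfolding cospoly_def by (intro continuous_intros)
    show "?f (x + pi) = ?f x" for x by (rule cospoly_add_pi)
    show "?f (- x) = ?f x" for x by (simp add: cospoly_def)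
    show "(?f x)\<^sup>2 - e\<^sup>2 = poly (Q\<^sup>2 - [:e\<^sup>2:]) (cos (2 * x))" for x by (simp add: Q)
    show "degree (Q\<^sup>2 - [:e\<^sup>2:]) \<le> 2 * (2049 * 2 ^ t - 1)"
      using degree_power_le[of Q 2] Q(1) by (intro degree_diff_le) auto
    show "e \<le> \<bar>?f x\<bar>" if near: "\<bar>x - pi / 2 * of_int m\<bar> \<le> 101 * (pi / real n)" for x and m :: int
    proof -
      \<comment> \<open>At the multiple of pi/2 the value is \<open>?M\<close>; the derivative bound
        lets it drop by at most \<open>606 * h * ?M\<close> within 101 cells, less than
        half.\<close>
      have "\<bar>?f x - ?M\<bar> \<le> 2 * 3 ^ Suc 0 * ?M * \<bar>2048 * ?T * x - 2048 * ?T * (pi / 2 * of_int m)\<bar>"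
        using rsF_lipschitz[of t 0 "2048 * ?T * x" "2048 * ?T * (pi / 2 * of_int m)"]
        unfolding cospoly_rs_eps rsF_half_pi[OF \<open>odd t\<close>] .
      also have "\<dots> \<le> 2 * 3 ^ Suc 0 * ?M * (101 * h)"
        using M cell[OF near] by (intro mult_left_mono) auto
      also have "\<dots> = 606 * h * ?M" by simp
      also have "\<dots> \<le> (1 / 2) * ?M"
        using h_le M by (intro mult_right_mono) auto
      finally have "\<bar>?f x\<bar> \<ge> ?M / 2" by linarith
      moreover have "h ^ 3 * ?M \<le> 1 * ?M"
        using h_pos h_le M by (intro mult_right_mono power_le_one) auto
      ultimately show ?thesis using eh M by linarith
    qed
    show "\<exists>i\<in>{r..<r + 7}. \<forall>x. pi / real n * of_int i \<le> x \<and> x \<le> pi / real n * of_int (i + 1) \<longrightarrow> e \<le> \<bar>?f x\<bar>" for r :: int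
    proof (rule ccontr)
      assume "\<not> ?thesis"
      then have "\<forall>i\<in>{r..<r + 7}. \<exists>x. pi / real n * of_int i \<le> x \<and> x \<le> pi / real n * of_int (i + 1) \<and> \<bar>?f x\<bar> < e"
        by (auto simp: not_le)
      then obtain x where x: "\<And>i. i \<in> {r..<r + 7} \<Longrightarrow> pi / real n * of_int i \<le> x i"
        "\<And>i. i \<in> {r..<r + 7} \<Longrightarrow> x i \<le> pi / real n * of_int (i + 1)"
        "\<And>i. i \<in> {r..<r + 7} \<Longrightarrow> \<bar>?f (x i)\<bar> < e"
        by metis
      define u where "u i = 2048 * ?T * x i" for i
      have u: "h * of_int i \<le> u i" "u i \<le> h * of_int i + h" "\<bar>rsF t 0 (u i)\<bar> \<le> e" if "i \<in> {r..<r + 7}" for i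
      proof -
        have eq: "2048 * ?T * (pi / real n * of_int i) = h * of_int i"
          "2048 * ?T * (pi / real n * of_int (i + 1)) = h * of_int i + h"
          by (simp_all add: h_def distrib_left)
        show "h * of_int i \<le> u i"
          unfolding u_def eq(1)[symmetric] using x(1)[OF that] by (intro mult_left_mono) auto
        show "u i \<le> h * of_int i + h"
          unfolding u_def eq(2)[symmetric] using x(2)[OF that] by (intro mult_left_mono) auto
        show "\<bar>rsF t 0 (u i)\<bar> \<le> e"
          using x(3)[OF that] unfolding u_def cospoly_rs_eps by simp
      qed
      have shift: "h * of_int (r + k) = h * of_int r + of_int k * h" for k
        by (simp add: algebra_simps)
      \<comment> \<open>Taking every second of the seven cells keeps consecutive points at least
        \<open>h\<close> apart and all of them within \<open>7 * h\<close>.\<close>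
      have b: "h * of_int r + of_int k * h \<le> u (r + k)" "u (r + k) \<le> h * of_int r + of_int k * h + h"
        "\<bar>rsF t 0 (u (r + k))\<bar> \<le> e" if "k \<in> {0, 2, 4, 6}" for k
        using u[of "r + k"] that unfolding shift by auto
      show False
      proof (rule rsF_not_four_small[OF h_pos h_le _ _ _ _ eh])
        show "u (r + 0) + h \<le> u (r + 2)" "u (r + 2) + h \<le> u (r + 4)" "u (r + 4) + h \<le> u (r + 6)"
          "u (r + 6) - u (r + 0) \<le> 7 * h"
          using b[of 0] b[of 2] b[of 4] b[of 6] by (simp_all; linarith)+
      qed (use b(3)[of 0] b(3)[of 2] b(3)[of 4] b(3)[of 6] in auto)
    qed
  qed
qed

theorem theorem2p3:
  shows "\<exists>N0::nat. \<forall>n::nat. \<forall>t::nat. n \<ge> N0 \<and> odd t \<and>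
           2 powr (-43) < gamma_par n t \<and> gamma_par n t \<le> 2 powr (-40) \<longrightarrow>
           (\<exists>(eps :: nat \<Rightarrow> real) (\<I> :: real set set).
              (\<forall>k\<in>Cset t. eps k = 1 \<or> eps k = -1)
            \<and> suitable n \<I> \<and> suitable_card n (gamma_par n t) \<I> \<and> well_separated n \<I>
            \<and> (\<forall>\<theta>. \<theta> \<notin> \<Union>\<I> \<longrightarrow> \<bar>cospoly eps (Cset t) \<theta>\<bar> \<ge> delta_par n t * sqrt (real n))
            \<and> (\<forall>\<theta>. \<bar>cospoly eps (Cset t) \<theta>\<bar> \<le> sqrt (real n)))"
proof (intro exI[of _ 1] allI impI, elim conjE)
  fix n t :: nat
  define g where "g = gamma_par n t"
  assume n: "1 \<le> n" and "odd t" and "2 powr (-43) < gamma_par n t" "gamma_par n t \<le> 2 powr (-40)"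
  then have g: "0 < g" "g \<le> 2 powr (-40)"
    unfolding g_def by (auto intro: less_trans[of 0 "2 powr (-43)"])
  have gn: "g * real n = 2049 * 2 ^ t - 1"
    using n by (simp add: g_def gamma_par_def power_add)
  obtain P where "threshold_cells n (cospoly (rs_eps t) (Cset t)) (delta_par n t * sqrt (real n)) (2049 * 2 ^ t - 1) P"
    using threshold_cells_rs[OF _ \<open>odd t\<close> g gn refl] n unfolding delta_par_def g_def by auto
  then interpret threshold_cells n "cospoly (rs_eps t) (Cset t)" "delta_par n t * sqrt (real n)" "2049 * 2 ^ t - 1" P .
  \<comment> \<open>The largest frequency in \<open>Cprime t\<close>, which bounds the number of
    arcs per quadrant, is exactly \<open>g * n\<close>.\<close>
  have "real (2049 * 2 ^ t - 1) = g * real n"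
    unfolding gn by (subst of_nat_diff) auto
  then have "suitable_card n g arcs"
    by (intro suitable_card_arcs) simp
  \<comment> \<open>Each block is at most \<open>rsM t\<close> in modulus, and the square of twice
    this, \<open>8 * 2 ^ t\<close>, is below \<open>g * n\<close>, hence below
    \<open>n\<close>.\<close>
  moreover have "\<bar>cospoly (rs_eps t) (Cset t) \<theta>\<bar> \<le> sqrt (real n)" for \<theta>
  proof -
    have "\<bar>cospoly (rs_eps t) (Cset t) \<theta>\<bar> \<le> 2 * rsM t"
      using abs_rsF_le[of t 0] by (simp add: cospoly_rs_eps)
    also have "\<dots> = sqrt (8 * 2 ^ t)"
      using real_sqrt_mult[of "2\<^sup>2" "2 * 2 ^ t"] by simp
    also have "8 * 2 ^ t \<le> (2049 * 2 ^ t - 1 :: real)"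
      by (simp add: algebra_simps) (use one_le_power[of "2::real" t] in linarith)
    then have "sqrt (8 * 2 ^ t) \<le> sqrt (real n)"
    proof (intro real_sqrt_le_mono)
      assume "8 * 2 ^ t \<le> (2049 * 2 ^ t - 1 :: real)"
      also have "\<dots> \<le> 1 * real n"
        unfolding gn[symmetric] using g powr_mono[of "-40" 0 "2::real"] by (intro mult_right_mono) auto
      finally show "8 * 2 ^ t \<le> real n" by simp
    qed
    finally show ?thesis .
  qed
  ultimately show "\<exists>eps \<I>. (\<forall>k\<in>Cset t. eps k = 1 \<or> eps k = -1)
      \<and> suitable n \<I> \<and> suitable_card n (gamma_par n t) \<I> \<and> well_separated n \<I>
      \<and> (\<forall>\<theta>. \<theta> \<notin> \<Union>\<I> \<longrightarrow> \<bar>cospoly eps (Cset t) \<theta>\<bar> \<ge> delta_par n t * sqrt (real n))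
      \<and> (\<forall>\<theta>. \<bar>cospoly eps (Cset t) \<theta>\<bar> \<le> sqrt (real n))"
    unfolding g_def
    by (intro exI[of _ "rs_eps t"] exI[of _ arcs])
      (auto simp: rs_eps_sign suitable_arcs well_separated_arcs outside_arcs)
qed

end
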